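(* Let $T$ be a maximal planar graph (a simple graph embedded in the sphere in which every face is a triangle) with $n\geq 4$ vertices. Then every non-rainbow coloring of $T$ uses at most $\left\lfloor\frac{2n-1}{3}\right\rfloor$ colors. Let $T$ be a maximal graph embedded in the projective plane (a simple graph embedded in the projective plane in which every face is a triangle) with $n\geq 4$ vertices. Then every non-rainbow coloring of $T$ uses at most $\left\lfloor\frac{2n+1}{3}\right\rfloor$ colors.
   Context: A $k$-coloring of a graph $G$ is a surjective map $f:V(G)\to\{1,\dots,k\}$ (not necessarily proper); it is said to use $k$ colors. For a graph embedded on a surface, a face is rainbow if its vertices receive mutually distinct colors, and a coloring is non-rainbow if no face is rainbow. *)

theory Defs
  imports "HOL-Analysis.Analysis"
begin

definition simple_graph :: "'v set \<Rightarrow> 'v set set \<Rightarrow> bool" where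
  "simple_graph V E \<longleftrightarrow> finite V \<and> E \<subseteq> {e. e \<subseteq> V \<and> card e = 2}"

definition sphere_surface :: "'a topology \<Rightarrow> bool" where
  "sphere_surface X \<longleftrightarrow> X homeomorphic_space top_of_set (sphere (0 :: real^3) 1)"

text \<open>The quotient of the unit sphere by the antipodal map.\<close>

definition projective_plane_surface :: "'a topology \<Rightarrow> bool" where
  "projective_plane_surface X \<longleftrightarrow>
    (\<exists>q. quotient_map (top_of_set (sphere (0 :: real^3) 1)) X q \<and>
         (\<forall>x\<in>sphere 0 1. \<forall>y\<in>sphere 0 1. q x = q y \<longleftrightarrow> y = x \<or> y = - x))"

text \<open>An embedding of the graph \<open>(V, E)\<close> in \<open>X\<close> is given by the points \<open>pt v\<close> representing
  the vertices and the point sets \<open>curve e\<close> of the arcs representing the edges.\<close>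

definition embedded_graph ::
  "'a topology \<Rightarrow> 'v set \<Rightarrow> 'v set set \<Rightarrow> ('v \<Rightarrow> 'a) \<Rightarrow> ('v set \<Rightarrow> 'a set) \<Rightarrow> bool" where
  "embedded_graph X V E pt curve \<longleftrightarrow>
    simple_graph V E \<and>
    inj_on pt V \<and> pt ` V \<subseteq> topspace X \<and>
    (\<forall>e\<in>E. \<exists>g. embedding_map (top_of_set {0..1::real}) X g \<and>
                {g 0, g 1} = pt ` e \<and> g ` {0..1} = curve e) \<and>
    (\<forall>e\<in>E. curve e \<inter> pt ` V = pt ` e) \<and>
    (\<forall>e\<in>E. \<forall>e'\<in>E. e \<noteq> e' \<longrightarrow> curve e \<inter> curve e' = pt ` (e \<inter> e'))"

definition faces ::
  "'a topology \<Rightarrow> 'v set \<Rightarrow> 'v set set \<Rightarrow> ('v \<Rightarrow> 'a) \<Rightarrow> ('v set \<Rightarrow> 'a set) \<Rightarrow> 'a set set" where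
  "faces X V E pt curve =
    connected_components_of (subtopology X (topspace X - (pt ` V \<union> \<Union> (curve ` E))))"

definition face_vertices :: "'a topology \<Rightarrow> 'v set \<Rightarrow> ('v \<Rightarrow> 'a) \<Rightarrow> 'a set \<Rightarrow> 'v set" where
  "face_vertices X V pt F = {v \<in> V. pt v \<in> X closure_of F}"

text \<open>A triangular face is the interior of a closed disc whose boundary circle is a 3-cycle
  of the graph.\<close>

definition triangular_face ::
  "'a topology \<Rightarrow> 'v set set \<Rightarrow> ('v set \<Rightarrow> 'a set) \<Rightarrow> 'a set \<Rightarrow> bool" where
  "triangular_face X E curve F \<longleftrightarrow>
    (\<exists>a b c h. a \<noteq> b \<and> b \<noteq> c \<and> c \<noteq> a \<and> {a, b} \<in> E \<and> {b, c} \<in> E \<and> {c, a} \<in> E \<and>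
       embedding_map (top_of_set (cball (0 :: real^2) 1)) X h \<and>
       h ` ball 0 1 = F \<and>
       h ` sphere 0 1 = curve {a, b} \<union> curve {b, c} \<union> curve {c, a})"

definition triangular_embedding ::
  "'a topology \<Rightarrow> 'v set \<Rightarrow> 'v set set \<Rightarrow> ('v \<Rightarrow> 'a) \<Rightarrow> ('v set \<Rightarrow> 'a set) \<Rightarrow> bool" where
  "triangular_embedding X V E pt curve \<longleftrightarrow>
    embedded_graph X V E pt curve \<and>
    (\<forall>F \<in> faces X V E pt curve. triangular_face X E curve F)"

definition k_coloring :: "'v set \<Rightarrow> nat \<Rightarrow> ('v \<Rightarrow> nat) \<Rightarrow> bool" where
  "k_coloring V k f \<longleftrightarrow> f ` V = {1..k}"

definition rainbow_face ::
  "'a topology \<Rightarrow> 'v set \<Rightarrow> ('v \<Rightarrow> 'a) \<Rightarrow> ('v \<Rightarrow> nat) \<Rightarrow> 'a set \<Rightarrow> bool" where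
  "rainbow_face X V pt f F \<longleftrightarrow> inj_on f (face_vertices X V pt F)"

definition non_rainbow ::
  "'a topology \<Rightarrow> 'v set \<Rightarrow> 'v set set \<Rightarrow> ('v \<Rightarrow> 'a) \<Rightarrow> ('v set \<Rightarrow> 'a set) \<Rightarrow>
    ('v \<Rightarrow> nat) \<Rightarrow> bool" where
  "non_rainbow X V E pt curve f \<longleftrightarrow>
    (\<forall>F \<in> faces X V E pt curve. \<not> rainbow_face X V pt f F)"

end

theory Submission
  imports Defs
begin

text \<open>In a non-rainbow coloring every face sees one or two colors. The triangulation is connected, so at
  least \<open>k - 1\<close> pairs of colors occur on edges. Each such pair is the color set of at least three
  faces: an edge \<open>uv\<close> with two colors lies on two faces \<open>uvw\<close> and \<open>uvx\<close> with \<open>w \<noteq> x\<close>, one of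
  \<open>uw\<close>, \<open>vw\<close> has the same two colors, and this edge lies on a further face. Hence \<open>3 (k - 1) \<le> |F|\<close>,
  and \<open>|F| \<le> 2 n - 2 \<chi>\<close> by Euler's formula.

  The inequality \<open>|V| - |E| + |F| \<ge> \<chi>\<close> is proved on the sphere by adding one arc at a time: an arc
  that closes a cycle splits a face by the Jordan curve theorem. For the projective plane the graph is
  lifted to the sphere along the double cover. That an edge lies on exactly two faces follows
  from invariance of domain.\<close>

section \<open>Graphs on the sphere\<close>

text \<open>The two apexes w and x over an edge differ because two faces on the same three vertices
  would close up to the whole surface; n >= 4 excludes this. Only one direction of Euler's formula
  is needed: 3|F| <= 2|E| and |V| - |E| + |F| >= \<chi> together give |F| <= 2n - 2\<chi>. For this
  direction it suffices to exhibit some partition of the complement of the graph into many open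
  pieces, and these pieces need not be shown connected. What is connected are the faces, being
  discs: the lift of a disc cannot meet two pieces, which bounds their number. Both surfaces are
  handled together as images of the sphere under a d-to-one map with d = 1 or d = 2. Lifting
  multiplies the numbers of vertices, edges and face discs by d, while the constant 2 of the sphere
  stays as it is, so below the inequality holds with \<chi> = 2/d. Finiteness of the set of faces is
  not part of the definitions; it is derived from the local structure at an edge.\<close>

abbreviation S2 :: "(real^3) set" where "S2 \<equiv> sphere 0 1"

lemma minus_sphere_neq:
  fixes x :: "real^3"
  assumes "x \<in> S2" shows "- x \<noteq> x"
proof
  assume "- x = x"
  then have "x + x = 0" by (metis add.right_inverse)
  then have "2 *\<^sub>R x = 0" by (simp add: scaleR_2)
  then show False using assms by simp
qed

text \<open>The plane is kept abstract because invariance of domain is applied in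
  \<open>real^2\<close> and the Jordan curve theorem in \<open>complex\<close>.\<close>

lemma stereographic:
  fixes N :: "real^3"
  assumes "N \<in> S2" "DIM('b::euclidean_space) = 2"
  shows "\<exists>p r. homeomorphism (S2 - {N}) (UNIV :: 'b set) p r"
  using homeomorphic_punctured_sphere_affine[of 1 N 0 "UNIV :: 'b set"] assms
  by (simp add: homeomorphic_def)

section \<open>Invariance of domain on the sphere\<close>

lemma openin_punctured_sphere:
  fixes U :: "(real^3) set"
  assumes "openin (top_of_set (S2 - {N})) U"
  shows "openin (top_of_set S2) U"
  using assms openin_trans[of "S2 - {N}" U S2] openin_delete[OF openin_subtopology_self, of S2 N] by blast

lemma openin_homeomorphism_vimage:
  assumes "homeomorphism A (UNIV :: 'b::topological_space set) p r" "open S"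
  shows "openin (top_of_set A) (r ` S)"
proof -
  have "r ` S = A \<inter> p -` S"
    using assms(1) unfolding homeomorphism_def by force
  moreover have "openin (top_of_set A) (A \<inter> p -` S)"
    using assms continuous_openin_preimage_gen homeomorphism_cont1 by blast
  ultimately show ?thesis by simp
qed

text \<open>Openness is local. Near an image point x, projection from the antipode -x turns the map
  into one between planes, to which invariance of domain applies; the inverse projection carries the
  open image back.\<close>

lemma invariance_of_domain_to_sphere:
  fixes k :: "real^2 \<Rightarrow> real^3"
  assumes "open W" and cont: "continuous_on W k" and kS: "k ` W \<subseteq> S2" and inj: "inj_on k W"
  shows "openin (top_of_set S2) (k ` W)"
proof (subst openin_subopen, intro ballI)
  fix x assume "x \<in> k ` W"
  have xS: "x \<in> S2" using \<open>x \<in> k ` W\<close> kS by blast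
  then have "- x \<in> S2" by simp
  then obtain p r where pr: "homeomorphism (S2 - {-x}) (UNIV :: (real^2) set) p r"
    using stereographic[of "-x", where 'b = "real^2"] by auto
  define W' where "W' = W \<inter> k -` (- {-x})"
  have "open W'"
    unfolding W'_def using cont \<open>open W\<close> by (intro continuous_open_preimage) auto
  have W'S: "k ` W' \<subseteq> S2 - {-x}"
    using kS by (auto simp: W'_def)
  have "continuous_on W' (p \<circ> k)"
    using pr W'S cont
    by (intro continuous_on_compose)
       (auto simp: homeomorphism_def W'_def intro: continuous_on_subset)
  moreover have "inj_on (p \<circ> k) W'"
  proof (rule comp_inj_on)
    show "inj_on k W'" using inj by (auto simp: W'_def inj_on_def)
    have "inj_on p (S2 - {-x})"
      by (rule inj_on_inverseI[of _ r]) (use pr in \<open>auto simp: homeomorphism_def\<close>)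
    then show "inj_on p (k ` W')" using W'S inj_on_subset by blast
  qed
  ultimately have "open ((p \<circ> k) ` W')"
    using \<open>open W'\<close> invariance_of_domain by blast
  then have "openin (top_of_set (S2 - {-x})) (r ` (p \<circ> k) ` W')"
    using openin_homeomorphism_vimage pr by blast
  moreover have "r ` (p \<circ> k) ` W' = k ` W'"
  proof -
    have "r (p (k w)) = k w" if "w \<in> W'" for w
      using that W'S by (intro homeomorphism_apply1[OF pr]) blast
    then show ?thesis by (simp add: image_comp)
  qed
  ultimately have "openin (top_of_set S2) (k ` W')"
    using openin_punctured_sphere[of "-x" "k ` W'"] by simp
  moreover have "x \<in> k ` W'"
    using minus_sphere_neq[OF xS] \<open>x \<in> k ` W\<close> unfolding W'_def by fastforce
  moreover have "k ` W' \<subseteq> k ` W"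
    by (auto simp: W'_def)
  ultimately show "\<exists>T. openin (top_of_set S2) T \<and> x \<in> T \<and> T \<subseteq> k ` W" by blast
qed

lemma invariance_of_domain_from_sphere:
  fixes f :: "real^3 \<Rightarrow> real^2"
  assumes "openin (top_of_set S2) U" "continuous_on U f" "inj_on f U"
  shows "open (f ` U)"
  using invariance_of_domain_sphere_affine_set[of U f UNIV 1 0] assms by auto

text \<open>Placed on a coordinate axis of \<open>real^2\<close>, the values would form an open set
  by invariance of domain, yet a line has empty interior.\<close>

lemma continuous_inj_to_real_sphere:
  fixes f :: "real^3 \<Rightarrow> real"
  assumes "openin (top_of_set S2) U" "continuous_on U f" "inj_on f U"
  shows "U = {}"
proof -
  let ?a = "axis 1 1 :: real^2"
  let ?g = "\<lambda>x. f x *\<^sub>R ?a"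
  have "open (?g ` U)"
    using assms
    by (intro invariance_of_domain_from_sphere)
       (auto intro!: continuous_intros simp: inj_on_def axis_eq_0_iff)
  moreover have "?g ` U \<subseteq> {z. z $ 2 = 0}"
    by (auto simp: axis_def)
  moreover have "interior {z :: real^2. z $ 2 = 0} = {}"
    by (rule interior_standard_hyperplane)
  ultimately show ?thesis
    by (metis image_is_empty interior_maximal subset_empty)
qed

lemma arc_empty_interior_sphere:
  assumes "arc (g :: real \<Rightarrow> real^3)" "openin (top_of_set S2) U" "U \<subseteq> path_image g"
  shows "U = {}"
proof -
  obtain h where h: "homeomorphism {0..1} (path_image g) g h"
    using homeomorphism_arc assms(1) by blast
  have "continuous_on U h"
    using h assms(3) continuous_on_subset homeomorphism_cont2 by blast
  moreover have "inj_on h U"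
    using h assms(3) by (metis homeomorphism_apply2 inj_on_inverseI inj_on_subset)
  ultimately show ?thesis
    using assms(2) continuous_inj_to_real_sphere by blast
qed

text \<open>The planar theorem after stereographic projection from N. The last clause transfers the
  fact that every point of the curve is on the frontier of both sides; it later guarantees that a
  region crossed by the curve falls into two nonempty parts.\<close>

lemma Jordan_sphere:
  fixes c :: "real \<Rightarrow> real^3"
  assumes c: "simple_path c" "pathfinish c = pathstart c"
    and cS: "path_image c \<subseteq> S2" and N: "N \<in> S2" "N \<notin> path_image c"
  obtains A B where "openin (top_of_set S2) A" "openin (top_of_set S2) B" "A \<inter> B = {}"
    "A \<union> B = S2 - path_image c"
    "\<And>x U. x \<in> path_image c \<Longrightarrow> openin (top_of_set S2) U \<Longrightarrow> x \<in> U \<Longrightarrow> U \<inter> A \<noteq> {} \<and> U \<inter> B \<noteq> {}"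
proof -
  obtain p r where pr: "homeomorphism (S2 - {N}) (UNIV :: complex set) p r"
    using stereographic[OF N(1), where 'b = complex] by auto
  have cN: "path_image c \<subseteq> S2 - {N}" using cS N by blast
  have rp: "r (p x) = x" if "x \<in> S2 - {N}" for x
    using homeomorphism_apply1[OF pr that] .
  have prr: "p (r z) = z" for z
    using homeomorphism_apply2[OF pr] by simp
  have rS: "r z \<in> S2 - {N}" for z
    using homeomorphism_image2[OF pr] by blast
  have contr: "continuous_on UNIV r" and contp: "continuous_on (S2 - {N}) p"
    using pr homeomorphism_cont1 homeomorphism_cont2 by auto
  have injp: "inj_on p (S2 - {N})" by (rule inj_on_inverseI[of _ r]) (rule rp)
  define c' where "c' = p \<circ> c"
  let ?J = "path_image c'"
  have J: "?J = p ` path_image c" by (simp add: c'_def path_image_compose)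
  have c'simple: "simple_path c'"
    unfolding c'_def
    by (rule simple_path_continuous_image)
       (use c contp injp cN continuous_on_subset inj_on_subset in blast)+
  have c'loop: "pathfinish c' = pathstart c'"
    using c by (simp add: c'_def pathfinish_def pathstart_def)
  note jo = Jordan_inside_outside[OF c'simple c'loop]
  have rJ: "r ` ?J = path_image c"
    using rp cN unfolding J image_comp by force
  define I where "I = inside ?J"
  define A where "A = r ` I"
  have clI: "closure I = I \<union> ?J"
    using jo unfolding I_def by (metis closure_Un_frontier)
  have compI: "compact (closure I)"
    using jo unfolding I_def by (simp add: compact_closure)
  have rcl: "r ` closure I = A \<union> path_image c"
    by (simp add: clI A_def image_Un rJ)
  \<comment> \<open>Taking the complement of a compact set adds N to the image of the outside and
    makes openness at N immediate.\<close>
  define B where "B = S2 - r ` closure I"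
  show thesis
  proof
    have "open I" using jo by (simp add: I_def)
    then show opA: "openin (top_of_set S2) A"
      unfolding A_def using openin_homeomorphism_vimage[OF pr] openin_punctured_sphere by blast
    have "compact (r ` closure I)"
      using compI contr compact_continuous_image continuous_on_subset by blast
    then show opB: "openin (top_of_set S2) B"
      unfolding B_def by (metis closed_Compl compact_imp_closed Diff_eq openin_open_Int open_Compl)
    show "A \<inter> B = {}"
      by (auto simp: B_def rcl)
    have "A \<inter> path_image c = {}"
    proof -
      have "I \<inter> ?J = {}" by (simp add: I_def inside_no_overlap)
      moreover have "inj r" using prr by (metis injI)
      ultimately show ?thesis
        unfolding A_def rJ[symmetric] by (metis image_Int image_empty)
    qed
    moreover have "A \<subseteq> S2" using opA openin_imp_subset by blast
    ultimately show "A \<union> B = S2 - path_image c"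
      by (auto simp: B_def rcl)
    show "U \<inter> A \<noteq> {} \<and> U \<inter> B \<noteq> {}"
      if x: "x \<in> path_image c" and U: "openin (top_of_set S2) U" and xU: "x \<in> U" for x U
    proof -
      define U' where "U' = r -` U"
      obtain T where T: "open T" "U = S2 \<inter> T" using U by (auto simp: openin_open)
      have "U' = r -` T" using T rS by (auto simp: U'_def)
      then have "open U'"
        using contr T open_vimage by blast
      have px: "p x \<in> ?J" using x J by blast
      have "p x \<in> U'" using rp[of x] x cN xU unfolding U'_def by (metis subsetD vimageI)
      have "p x \<in> frontier I" "p x \<in> frontier (outside ?J)"
        using jo px by (auto simp: I_def)
      then have "p x \<in> closure I" "p x \<in> closure (outside ?J)"
        by (auto simp: frontier_def)
      then obtain u v where u: "u \<in> U'" "u \<in> I" and v: "v \<in> U'" "v \<in> outside ?J"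
        using open_Int_closure_eq_empty[OF \<open>open U'\<close>, of I] open_Int_closure_eq_empty[OF \<open>open U'\<close>, of "outside ?J"]
          \<open>p x \<in> U'\<close> by blast
      have "r u \<in> U \<inter> A" using u by (auto simp: U'_def A_def)
      moreover have "v \<notin> I" "v \<notin> ?J"
        using v(2) inside_Int_outside[of ?J] outside_no_overlap[of ?J] unfolding I_def by blast+
      then have "v \<notin> closure I" by (simp add: clI)
      then have "r v \<notin> r ` closure I" using prr by (metis (no_types) image_iff)
      then have "r v \<in> U \<inter> B" using v rS by (auto simp: U'_def B_def)
      ultimately show ?thesis by blast
    qed
  qed
qed

section \<open>Euler's inequality for arcs on the sphere\<close>

lemma infinite_S2: "infinite S2"
proof
  assume fin: "finite S2"
  have "connected S2" by (rule connected_sphere) simp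
  then have "S2 = {} \<or> (\<exists>a. S2 = {a})"
    using fin connected_finite_iff_sing by blast
  moreover have a: "axis 1 1 \<in> S2" by simp
  moreover have "- axis 1 1 \<in> S2" by simp
  ultimately show False using minus_sphere_neq[OF a] by (metis empty_iff singletonD)
qed

text \<open>Edges are bare point sets and P is independent of them, so isolated points are allowed:
  arcs can be removed one by one while P stays fixed, down to no arcs at all.\<close>

definition arc_system :: "(real^3) set \<Rightarrow> (real^3) set set \<Rightarrow> bool" where
  "arc_system P \<C> \<longleftrightarrow> finite P \<and> P \<subseteq> S2 \<and> finite \<C> \<and>
     (\<forall>e\<in>\<C>. e \<subseteq> S2 \<and> (\<exists>g. arc g \<and> path_image g = e \<and> e \<inter> P = {pathstart g, pathfinish g})) \<and>
     (\<forall>e\<in>\<C>. \<forall>e'\<in>\<C>. e \<noteq> e' \<longrightarrow> e \<inter> e' \<subseteq> P)"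

text \<open>The labelling \<open>lab\<close> groups vertices that are connected by the graph and \<open>\<Q>\<close> is a partition of the
  complement into open sets; both are witnesses, so that neither components of the graph nor
  finiteness of the number of faces have to be considered in the induction.\<close>

lemma sphere_Euler_aux:
  assumes "finite \<C>" "arc_system P \<C>"
  shows "\<exists>\<Q> (lab :: real^3 \<Rightarrow> real^3). finite \<Q> \<and> (\<forall>U\<in>\<Q>. openin (top_of_set S2) U \<and> U \<noteq> {}) \<and> disjoint \<Q> \<and>
           \<Union>\<Q> = S2 - (P \<union> \<Union>\<C>) \<and>
           (\<forall>x\<in>P. \<forall>y\<in>P. lab x = lab y \<longrightarrow> path_component (P \<union> \<Union>\<C>) x y) \<and>
           card \<C> + 1 + card (lab ` P) \<le> card \<Q> + card P"
  using assms
proof (induction \<C> rule: finite_induct)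
  case empty
  then have P: "finite P" by (auto simp: arc_system_def)
  have "S2 - P \<noteq> {}" using infinite_S2 P by (metis Diff_eq_empty_iff finite_subset)
  moreover have "openin (top_of_set S2) (S2 - P)"
    using P by (metis Diff_eq finite_imp_closed openin_open_Int open_Compl)
  ultimately show ?case
    by (intro exI[of _ "{S2 - P}"] exI[of _ "\<lambda>x. x"]) (auto simp: path_component_refl)
next
  case (insert e \<C>)
  have sys: "arc_system P \<C>"
    using insert.prems by (simp add: arc_system_def)
  then have finP: "finite P" by (simp add: arc_system_def)
  let ?G = "P \<union> \<Union>\<C>"
  obtain g where g: "arc g" "path_image g = e" "e \<inter> P = {pathstart g, pathfinish g}" and eS: "e \<subseteq> S2"
    using insert.prems by (auto simp: arc_system_def)
  have eG: "e \<inter> ?G = {pathstart g, pathfinish g}"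
    using insert.prems insert.hyps g(3) unfolding arc_system_def by fastforce
  obtain \<Q> and lab :: "real^3 \<Rightarrow> real^3" where finQ: "finite \<Q>"
    and "\<forall>U\<in>\<Q>. openin (top_of_set S2) U \<and> U \<noteq> {}"
    and disQ: "disjoint \<Q>" and UQ: "\<Union>\<Q> = S2 - ?G"
    and "\<forall>x\<in>P. \<forall>y\<in>P. lab x = lab y \<longrightarrow> path_component ?G x y"
    and card: "card \<C> + 1 + card (lab ` P) \<le> card \<Q> + card P"
    using insert.IH[OF sys] by (elim exE conjE)
  then have Q: "\<And>U. U \<in> \<Q> \<Longrightarrow> openin (top_of_set S2) U \<and> U \<noteq> {}"
    and lab: "\<And>x y. x \<in> P \<Longrightarrow> y \<in> P \<Longrightarrow> lab x = lab y \<Longrightarrow> path_component ?G x y"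
    by auto
  have compe: "closed e" using g closed_arc_image by blast
  have ope: "openin (top_of_set S2) (U - e)" if "U \<in> \<Q>" for U
    using Q[OF that] compe by (metis openin_diff closedin_closed_Int inf_commute Int_absorb2 eS closed_subset)
  \<comment> \<open>An arc has empty interior, so deleting it empties no region.\<close>
  have nee: "U - e \<noteq> {}" if "U \<in> \<Q>" for U
    using Q[OF that] arc_empty_interior_sphere[OF g(1), of U] g(2) by blast
  have xy: "pathstart g \<noteq> pathfinish g" "pathstart g \<in> P" "pathfinish g \<in> P" "pathstart g \<in> e" "pathfinish g \<in> e"
    using g arc_distinct_ends[OF g(1)] by auto
  have injQ: "inj_on (\<lambda>U. U - e) \<Q>"
  proof (rule inj_onI)
    fix U V assume "U \<in> \<Q>" "V \<in> \<Q>" "U - e = V - e"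
    then have "U \<inter> V \<noteq> {}" using nee by blast
    then show "U = V" using disQ \<open>U \<in> \<Q>\<close> \<open>V \<in> \<Q>\<close> by (metis disjointD)
  qed
  have mono: "path_component (P \<union> \<Union>(insert e \<C>)) x y" if "path_component ?G x y" for x y
    by (rule path_component_of_subset[OF _ that]) auto
  have cardC: "card (insert e \<C>) = Suc (card \<C>)" using insert.hyps by simp
  show ?case
  proof (cases "lab (pathstart g) = lab (pathfinish g)")
    case False
    \<comment> \<open>The ends lie in different groups: the regions are only trimmed, and merging
      the two groups pays for the new arc with one label.\<close>
    define \<Q>' where "\<Q>' = (\<lambda>U. U - e) ` \<Q>"
    define lab' where "lab' = (\<lambda>z. if lab z = lab (pathfinish g) then lab (pathstart g) else lab z)"
    have "lab' ` P \<subseteq> lab ` P - {lab (pathfinish g)}"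
      using False xy by (auto simp: lab'_def)
    then have "card (lab' ` P) \<le> card (lab ` P - {lab (pathfinish g)})"
      using finP by (intro card_mono) auto
    moreover have "card (lab ` P) = Suc (card (lab ` P - {lab (pathfinish g)}))"
      using finP xy by (intro card.remove) auto
    ultimately have cl: "card (lab' ` P) + 1 \<le> card (lab ` P)" by simp
    have cq: "card \<Q>' = card \<Q>" unfolding \<Q>'_def by (rule card_image[OF injQ])
    have pe: "path_component (P \<union> \<Union>(insert e \<C>)) (pathstart g) (pathfinish g)"
      unfolding path_component_def using g by (intro exI[of _ g]) (auto simp: arc_imp_path)
    have lab': "path_component (P \<union> \<Union>(insert e \<C>)) x y" if "x \<in> P" "y \<in> P" "lab' x = lab' y" for x y
    proof -
      have *: "path_component (P \<union> \<Union>(insert e \<C>)) x y"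
        if "x \<in> P" "y \<in> P" "lab x = lab y" for x y
        using mono lab that by blast
      have **: "path_component (P \<union> \<Union>(insert e \<C>)) x (pathstart g)"
        if "x \<in> P" "lab x = lab (pathstart g) \<or> lab x = lab (pathfinish g)" for x
        using that *[OF \<open>x \<in> P\<close> xy(2)] *[OF \<open>x \<in> P\<close> xy(3)] pe
        by (meson path_component_trans path_component_sym)
      show ?thesis
      proof (cases "lab x = lab y")
        case True
        then show ?thesis using that * by blast
      next
        case False
        then have "lab x = lab (pathstart g) \<or> lab x = lab (pathfinish g)"
          "lab y = lab (pathstart g) \<or> lab y = lab (pathfinish g)"
          using that(3) by (auto simp: lab'_def split: if_splits)
        then show ?thesis
          using **[OF \<open>x \<in> P\<close>] **[OF \<open>y \<in> P\<close>] path_component_trans path_component_sym by blast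
      qed
    qed
    have "disjoint \<Q>'"
      unfolding \<Q>'_def using disQ by (auto simp: disjoint_def)
    moreover have "\<Union>\<Q>' = S2 - (P \<union> \<Union>(insert e \<C>))"
      using UQ by (auto simp: \<Q>'_def)
    ultimately show ?thesis
      using finQ ope nee lab' cl cq card cardC
      by (intro exI[of _ \<Q>'] exI[of _ lab']) (auto simp: \<Q>'_def)
  next
    case True
    \<comment> \<open>The ends are already joined in the old graph: an arc \<open>a\<close> back
      through it closes \<open>g\<close> to a Jordan curve, and the new arc is paid for by one more
      region.\<close>
    then have "path_component ?G (pathfinish g) (pathstart g)"
      using lab xy by metis
    then obtain h where h: "path h" "path_image h \<subseteq> ?G" "pathstart h = pathfinish g" "pathfinish h = pathstart g"
      by (auto simp: path_component_def)
    then obtain a where a: "arc a" "path_image a \<subseteq> ?G" "pathstart a = pathfinish g" "pathfinish a = pathstart g"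
      using path_contains_arc[OF h(1,3,4)] xy by (metis order_trans)
    define c where "c = g +++ a"
    have c: "simple_path c"
      unfolding c_def using g a eG by (intro simple_path_join_loop) auto
    have c2: "pathfinish c = pathstart c" using a by (simp add: c_def)
    have imc: "path_image c = e \<union> path_image a"
      unfolding c_def using a g by (simp add: path_image_join)
    have GS: "?G \<subseteq> S2" using sys by (auto simp: arc_system_def)
    have cS: "path_image c \<subseteq> S2" using imc eS a GS by blast
    \<comment> \<open>An inner point of the arc; it is off the old graph and so singles out the
      region U to be split.\<close>
    define x where "x = g (1/2)"
    have inj: "inj_on g {0..1}" using g by (simp add: arc_def)
    have "x \<in> e" using g by (auto simp: x_def path_image_def)
    moreover have "x \<noteq> g 0" "x \<noteq> g 1"
      using inj_onD[OF inj, of "1/2" 0] inj_onD[OF inj, of "1/2" 1] by (auto simp: x_def)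
    ultimately have "x \<notin> ?G"
      using eG by (auto simp: pathstart_def pathfinish_def)
    then obtain U where U: "U \<in> \<Q>" "x \<in> U" using UQ \<open>x \<in> e\<close> eS by blast
    then obtain N where N: "N \<in> U" "N \<notin> e" using nee by blast
    have NS: "N \<in> S2" "N \<notin> path_image c"
      using N U UQ a imc by blast+
    obtain A B where AB: "openin (top_of_set S2) A" "openin (top_of_set S2) B" "A \<inter> B = {}"
      "A \<union> B = S2 - path_image c" "U \<inter> A \<noteq> {} \<and> U \<inter> B \<noteq> {}"
      using Jordan_sphere[OF c c2 cS NS] U Q imc \<open>x \<in> e\<close> by (metis UnI1)
    \<comment> \<open>The other regions are trimmed too, which avoids showing that the arc runs
      inside U only.\<close>
    define \<Q>1 where "\<Q>1 = (\<lambda>U. U - e) ` (\<Q> - {U})"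
    define \<Q>' where "\<Q>' = insert (U \<inter> A) (insert (U \<inter> B) \<Q>1)"
    have Udis: "U \<inter> V = {}" if "V \<in> \<Q> - {U}" for V
      using disQ U that by (metis DiffE disjointD insertI1)
    have "card \<Q>1 = card (\<Q> - {U})"
      unfolding \<Q>1_def by (rule card_image) (use injQ inj_on_subset in blast)
    moreover have notin: "W \<notin> \<Q>1" if "W \<subseteq> U" "W \<noteq> {}" for W
      using that Udis unfolding \<Q>1_def by blast
    have "U \<inter> B \<notin> \<Q>1" "U \<inter> A \<notin> insert (U \<inter> B) \<Q>1"
      using notin[of "U \<inter> A"] notin[of "U \<inter> B"] AB by blast+
    moreover note this
    moreover have "finite \<Q>1" using finQ by (simp add: \<Q>1_def)
    moreover have "card \<Q> = Suc (card (\<Q> - {U}))"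
      using finQ U by (intro card.remove)
    ultimately have cq: "card \<Q>' = Suc (card \<Q>)"
      by (simp add: \<Q>'_def)
    have dis: "disjoint \<Q>'"
    proof -
      have "disjoint \<Q>1" unfolding \<Q>1_def using disQ by (auto simp: disjoint_def)
      moreover have dU: "W \<inter> U = {}" if "W \<in> \<Q>1" for W
        using that Udis unfolding \<Q>1_def by blast
      have "disjnt (U \<inter> A) (U \<inter> B)" "disjnt (U \<inter> A) W" "disjnt (U \<inter> B) W" if "W \<in> \<Q>1" for W
        using dU[OF that] AB(3) unfolding disjnt_def by blast+
      moreover have "disjnt (U \<inter> A) (U \<inter> B)"
        using AB(3) unfolding disjnt_def by blast
      ultimately show ?thesis
        unfolding \<Q>'_def by (auto simp: pairwise_insert disjnt_sym)
    qed
    \<comment> \<open>The return arc lies in the old graph, hence outside U, so within U the Jordan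
      curve is just the new arc.\<close>
    have "U \<inter> path_image c = U \<inter> e"
      using U UQ a imc by blast
    then have "U \<inter> A \<union> U \<inter> B = U - e"
      using AB(4) Q[OF U(1)] openin_imp_subset by fastforce
    then have "\<Union>\<Q>' = \<Union>((\<lambda>U. U - e) ` \<Q>)"
      using U by (auto simp: \<Q>'_def \<Q>1_def)
    also have "\<dots> = S2 - (P \<union> \<Union>(insert e \<C>))"
      using UQ by auto
    finally have UQ': "\<Union>\<Q>' = S2 - (P \<union> \<Union>(insert e \<C>))" .
    have "\<forall>V\<in>\<Q>'. openin (top_of_set S2) V \<and> V \<noteq> {}"
      using AB Q U ope nee by (auto simp: \<Q>'_def \<Q>1_def)
    moreover have "finite \<Q>'" using finQ by (simp add: \<Q>'_def \<Q>1_def)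
    ultimately show ?thesis
      using dis UQ' mono lab card cq cardC
      by (intro exI[of _ \<Q>'] exI[of _ lab]) auto
  qed
qed

text \<open>A nonempty P carries at least one label, which turns the 1 of the induction into
  2.\<close>

lemma sphere_Euler:
  assumes "arc_system P \<C>" "P \<noteq> {}"
  obtains \<Q> where "finite \<Q>" "\<And>U. U \<in> \<Q> \<Longrightarrow> openin (top_of_set S2) U \<and> U \<noteq> {}" "disjoint \<Q>"
    "\<Union>\<Q> = S2 - (P \<union> \<Union>\<C>)" "card \<C> + 2 \<le> card \<Q> + card P"
proof -
  have fin: "finite \<C>" "finite P" using assms by (auto simp: arc_system_def)
  obtain \<Q> and lab :: "real^3 \<Rightarrow> real^3" where Q: "finite \<Q>" "\<forall>U\<in>\<Q>. openin (top_of_set S2) U \<and> U \<noteq> {}" "disjoint \<Q>"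
    "\<Union>\<Q> = S2 - (P \<union> \<Union>\<C>)" "card \<C> + 1 + card (lab ` P) \<le> card \<Q> + card P"
    using sphere_Euler_aux[OF fin(1) assms(1)] by blast
  have "card (lab ` P) \<ge> 1"
    using fin assms(2) by (metis One_nat_def Suc_leI card_gt_0_iff finite_imageI image_is_empty)
  then show thesis using that[of \<Q>] Q by auto
qed

section \<open>Surfaces covered by the sphere\<close>

lemma embedding_mapD:
  assumes "embedding_map (top_of_set S) X h"
  obtains k where "continuous_map (top_of_set S) X h" "inj_on h S"
    "continuous_map (subtopology X (h ` S)) (top_of_set S) k" "\<And>z. z \<in> S \<Longrightarrow> k (h z) = z"
proof -
  have hm: "homeomorphic_map (top_of_set S) (subtopology X (h ` S)) h"
    using assms by (simp add: embedding_map_def)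
  then obtain k where k: "homeomorphic_maps (top_of_set S) (subtopology X (h ` S)) h k"
    using homeomorphic_map_maps by blast
  show thesis
    by (rule that[of k])
      (use k hm in \<open>auto simp: homeomorphic_maps_def homeomorphic_eq_everything_map continuous_map_in_subtopology\<close>)
qed

text \<open>The sheets over h. They are required to differ at every point, so that counting alone
  shows that they exhaust each fibre of size d.\<close>

definition lifts :: "(real^3 \<Rightarrow> 'a) \<Rightarrow> nat \<Rightarrow> 'b::topological_space set \<Rightarrow> ('b \<Rightarrow> 'a) \<Rightarrow> ('b \<Rightarrow> real^3) set \<Rightarrow> bool" where
  "lifts q d D h L \<longleftrightarrow> card L = d \<and>
     (\<forall>k\<in>L. continuous_on D k \<and> k ` D \<subseteq> S2 \<and> (\<forall>z\<in>D. q (k z) = h z)) \<and>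
     (\<forall>z\<in>D. inj_on (\<lambda>k. k z) L)"

text \<open>The properties of a d-fold covering by the sphere that are needed below; d = 1 serves
  the sphere and d = 2 the projective plane. Lifting is assumed once for the plane (faces) and once
  for the line (edges), since a locale assumption has a fixed domain type.\<close>

locale sphere_cover =
  fixes X :: "'a topology" and q :: "real^3 \<Rightarrow> 'a" and d :: nat
  assumes cont_q: "continuous_map (top_of_set S2) X q"
    and open_q: "open_map (top_of_set S2) X q"
    and surj_q: "q ` S2 = topspace X"
    and haus: "Hausdorff_space X"
    and d_pos: "0 < d"
    and fibre: "x \<in> topspace X \<Longrightarrow> card {y \<in> S2. q y = x} = d"
    and loc_inj: "y \<in> S2 \<Longrightarrow> \<exists>U. openin (top_of_set S2) U \<and> y \<in> U \<and> inj_on q U"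
    and lift_plane: "\<And>(D :: (real^2) set) h. convex D \<Longrightarrow> continuous_map (top_of_set D) X h \<Longrightarrow> \<exists>L. lifts q d D h L"
    and lift_line: "\<And>(D :: real set) h. convex D \<Longrightarrow> continuous_map (top_of_set D) X h \<Longrightarrow> \<exists>L. lifts q d D h L"
begin

lemma finite_fibre: "x \<in> topspace X \<Longrightarrow> finite {y \<in> S2. q y = x}"
  by (rule card_ge_0_finite) (simp only: fibre d_pos)

text \<open>The d lifts have d distinct values in a fibre that has exactly d points.\<close>

lemma lifts_fibre:
  assumes "lifts q d D h L" "z \<in> D"
  shows "{y \<in> S2. q y = h z} = (\<lambda>k. k z) ` L"
proof -
  have L: "card L = d" "inj_on (\<lambda>k. k z) L" and sub: "(\<lambda>k. k z) ` L \<subseteq> {y \<in> S2. q y = h z}"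
    using assms unfolding lifts_def by blast+
  have "L \<noteq> {}" using L d_pos by auto
  then obtain k where "k z \<in> S2" "q (k z) = h z" using sub by blast
  then have hz: "h z \<in> topspace X" unfolding surj_q[symmetric] by (intro image_eqI[of _ _ "k z"]) auto
  show ?thesis
    using card_subset_eq[OF finite_fibre[OF hz] sub] fibre[OF hz] card_image[OF L(2)] L(1) by simp
qed

lemma connected_X: "connected_space X"
proof -
  have "connectedin (top_of_set S2) S2"
    using connected_sphere[of "0::real^3" 1] by (simp add: connectedin_subtopology)
  then have "connectedin X (q ` S2)"
    using connectedin_continuous_map_image cont_q by blast
  then show ?thesis by (simp add: surj_q connectedin_topspace)
qed

text \<open>On a small ball f lifts to the sphere. The lift inherits injectivity from f, so its
  image is open there, and q is an open map.\<close>

lemma open_image_plane: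
  fixes W :: "(real^2) set"
  assumes "open W" "continuous_map (top_of_set W) X f" "inj_on f W"
  shows "openin X (f ` W)"
proof (subst openin_subopen, intro ballI)
  fix x assume "x \<in> f ` W"
  then obtain w where w: "w \<in> W" "x = f w" by blast
  then obtain r where r: "r > 0" "ball w r \<subseteq> W"
    using assms(1) open_contains_ball by blast
  have cf: "continuous_map (top_of_set (ball w r)) X f"
    using assms(2) r(2) by (metis continuous_map_from_subtopology_mono)
  obtain L where L: "lifts q d (ball w r) f L"
    using lift_plane[OF convex_ball cf] by blast
  then have "L \<noteq> {}" using d_pos by (auto simp: lifts_def)
  then obtain k where k: "continuous_on (ball w r) k" "k ` ball w r \<subseteq> S2" "\<forall>z\<in>ball w r. q (k z) = f z"
    using L by (auto simp: lifts_def)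
  have "inj_on f (ball w r)" using assms(3) r(2) inj_on_subset by blast
  then have "inj_on k (ball w r)"
    using k(3) unfolding inj_on_def by metis
  then have "openin (top_of_set S2) (k ` ball w r)"
    using invariance_of_domain_to_sphere[OF open_ball k(1,2)] by blast
  then have "openin X (q ` k ` ball w r)"
    using open_q by (simp add: open_map_def)
  moreover have "q ` k ` ball w r = f ` ball w r"
    using k(3) by (force simp: image_comp)
  ultimately show "\<exists>T. openin X T \<and> x \<in> T \<and> T \<subseteq> f ` W"
    using w r by (intro exI[of _ "f ` ball w r"]) auto
qed

text \<open>Moves questions about maps out of X to the sphere: composed with q on such a U, an
  injective map stays injective.\<close>

lemma local_section_open:
  assumes "openin X N" "x \<in> N"
  obtains U where "openin (top_of_set S2) U" "inj_on q U" "x \<in> q ` U" "q ` U \<subseteq> N"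
proof -
  obtain y where y: "y \<in> S2" "q y = x"
    using assms openin_subset surj_q by (metis image_iff subsetD)
  obtain U where U: "openin (top_of_set S2) U" "y \<in> U" "inj_on q U"
    using loc_inj[OF y(1)] by blast
  have "openin (top_of_set S2) {z \<in> S2. q z \<in> N}"
    using openin_continuous_map_preimage[OF cont_q assms(1)] by simp
  then have "openin (top_of_set S2) (U \<inter> {z \<in> S2. q z \<in> N})"
    using U(1) by blast
  moreover have "inj_on q (U \<inter> {z \<in> S2. q z \<in> N})"
    using U(3) by (rule inj_on_subset) blast
  moreover have "x \<in> q ` (U \<inter> {z \<in> S2. q z \<in> N})"
    using U(2) y assms(2) by (intro image_eqI[of _ _ y]) auto
  moreover have "q ` (U \<inter> {z \<in> S2. q z \<in> N}) \<subseteq> N" by blast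
  ultimately show thesis by (rule that)
qed

lemma continuous_on_comp_q:
  fixes k :: "'a \<Rightarrow> 'b::topological_space"
  assumes "openin (top_of_set S2) U" "q ` U \<subseteq> N" "continuous_map (subtopology X N) euclidean k"
  shows "continuous_on U (k \<circ> q)"
proof -
  have "continuous_map (top_of_set U) X q"
    using cont_q assms(1) by (metis continuous_map_from_subtopology_mono openin_imp_subset)
  then have "continuous_map (top_of_set U) (subtopology X N) q"
    using assms(2) by (simp add: continuous_map_in_subtopology image_subset_iff_funcset)
  then have "continuous_map (top_of_set U) euclidean (k \<circ> q)"
    using assms(3) continuous_map_compose by blast
  then show ?thesis by simp
qed

lemma open_image_chart:
  fixes k :: "'a \<Rightarrow> real^2"
  assumes "openin X N" "continuous_map (subtopology X N) euclidean k" "inj_on k N"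
  shows "open (k ` N)"
proof (subst open_subopen, intro ballI)
  fix z assume "z \<in> k ` N"
  then obtain x where x: "x \<in> N" "z = k x" by blast
  obtain U where U: "openin (top_of_set S2) U" "inj_on q U" "x \<in> q ` U" "q ` U \<subseteq> N"
    using local_section_open[OF assms(1) x(1)] .
  have "inj_on (k \<circ> q) U"
    using U assms(3) by (meson comp_inj_on inj_on_subset)
  then have "open ((k \<circ> q) ` U)"
    using invariance_of_domain_from_sphere[OF U(1) continuous_on_comp_q[OF U(1,4) assms(2)]] by blast
  then show "\<exists>T. open T \<and> z \<in> T \<and> T \<subseteq> k ` N"
    using U x by (intro exI[of _ "(k \<circ> q) ` U"]) auto
qed

text \<open>Serves to show that no nonempty open set of X lies inside the curve of an edge.\<close>

lemma continuous_inj_to_real: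
  fixes k :: "'a \<Rightarrow> real"
  assumes "openin X N" "continuous_map (subtopology X N) euclidean k" "inj_on k N"
  shows "N = {}"
proof (rule ccontr)
  assume "N \<noteq> {}"
  then obtain x where x: "x \<in> N" by blast
  obtain U where U: "openin (top_of_set S2) U" "inj_on q U" "x \<in> q ` U" "q ` U \<subseteq> N"
    using local_section_open[OF assms(1) x(1)] .
  have "inj_on (k \<circ> q) U"
    using U assms(3) by (meson comp_inj_on inj_on_subset)
  then have "U = {}"
    using continuous_inj_to_real_sphere[OF U(1) continuous_on_comp_q[OF U(1,4) assms(2)]] by blast
  then show False using U by blast
qed

text \<open>Two discs that share the part \<open>h1 ` A\<close> of their boundaries: extend \<open>h1\<close> beyond the unit circle by
  the reflection of \<open>h2\<close>, and apply invariance of domain.\<close>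

lemma glued_discs_open:
  fixes h1 h2 :: "real^2 \<Rightarrow> 'a"
  assumes h1: "embedding_map (top_of_set (cball 0 1)) X h1"
    and h2: "embedding_map (top_of_set (cball 0 1)) X h2"
    and dis: "h1 ` cball 0 1 \<inter> h2 ` ball 0 1 = {}"
    and A: "openin (top_of_set (sphere 0 1)) A" and Ah: "h1 ` A \<subseteq> h2 ` sphere 0 1"
  shows "openin X (h1 ` ball 0 1 \<union> h1 ` A \<union> h2 ` ball 0 1)"
proof -
  let ?D = "cball 0 1 :: (real^2) set"
  have c1: "continuous_map (top_of_set ?D) X h1" and i1: "inj_on h1 ?D"
    by (rule embedding_mapD[OF h1], assumption)+
  obtain k2 where c2: "continuous_map (top_of_set ?D) X h2" and i2: "inj_on h2 ?D"
    and ck2: "continuous_map (subtopology X (h2 ` ?D)) (top_of_set ?D) k2"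
    and k2: "\<And>z. z \<in> ?D \<Longrightarrow> k2 (h2 z) = z"
    using embedding_mapD[OF h2] by metis
  obtain T where T: "open T" "A = sphere 0 1 \<inter> T" using A by (auto simp: openin_open)
  have k2A: "h2 (k2 (h1 a)) = h1 a \<and> norm (k2 (h1 a)) = 1" if "a \<in> A" for a
    using Ah k2 that by (force simp: image_subset_iff)
  \<comment> \<open>The open cone of directions in A; together with the open disc it gives a planar
    neighbourhood W of A.\<close>
  define W1 where "W1 = {z :: real^2. z \<noteq> 0 \<and> sgn z \<in> T}"
  define W where "W = ball 0 1 \<union> W1"
  have sgnA: "sgn z \<in> A" if "z \<in> W1" for z
    using that T by (auto simp: W1_def norm_sgn)
  have sgn1: "sgn z = z" if "norm z = 1" for z :: "real^2"
    using that by (simp add: sgn_div_norm)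
  have "open (- {0} \<inter> sgn -` T)"
    using T by (intro continuous_open_preimage continuous_intros) auto
  moreover have "- {0} \<inter> sgn -` T = W1" by (auto simp: W1_def)
  ultimately have "open W" unfolding W_def by (metis open_Un open_ball)
  \<comment> \<open>\<open>v z\<close> is the point on the boundary of the second disc that is glued
    to the radial projection of z. Dividing it by \<open>norm z\<close> inverts the radius, so that
    points beyond the first circle enter the second disc.\<close>
  define v where "v = (\<lambda>z. k2 (h1 (sgn z)))"
  define f where "f = (\<lambda>z. if norm z \<le> 1 then h1 z else h2 (v z /\<^sub>R norm z))"
  have v: "norm (v z) = 1" "h2 (v z) = h1 (sgn z)" if "z \<in> W1" for z
    using k2A[OF sgnA[OF that]] by (auto simp: v_def)
  have contf: "continuous_map (top_of_set W) X f"
    unfolding f_def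
  proof (rule continuous_map_cases_le)
    show "continuous_map (top_of_set W) euclideanreal norm" "continuous_map (top_of_set W) euclideanreal (\<lambda>z. 1)"
      by (auto intro: continuous_intros)
    show "continuous_map (subtopology (top_of_set W) {z \<in> topspace (top_of_set W). norm z \<le> 1}) X h1"
      unfolding subtopology_subtopology
      by (rule continuous_map_from_subtopology_mono[OF c1]) auto
    let ?W = "W \<inter> {z. 1 \<le> norm z}"
    have W1: "?W \<subseteq> W1" by (auto simp: W_def)
    have "continuous_map (top_of_set ?W) (top_of_set ?D) sgn"
      using W1 by (auto intro!: continuous_intros simp: W1_def norm_sgn)
    then have "continuous_map (top_of_set ?W) X (h1 \<circ> sgn)"
      by (rule continuous_map_compose[OF _ c1])
    moreover have "(h1 \<circ> sgn) ` ?W \<subseteq> h2 ` ?D"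
      using W1 sgnA Ah by fastforce
    ultimately have "continuous_map (top_of_set ?W) (subtopology X (h2 ` ?D)) (h1 \<circ> sgn)"
      by (auto simp: continuous_map_in_subtopology)
    then have "continuous_map (top_of_set ?W) (top_of_set ?D) (k2 \<circ> (h1 \<circ> sgn))"
      by (rule continuous_map_compose[OF _ ck2])
    then have "continuous_on ?W v"
      by (simp add: v_def o_def)
    then have "continuous_on ?W (\<lambda>z. v z /\<^sub>R norm z)"
      by (intro continuous_intros) auto
    moreover have "norm (v z /\<^sub>R norm z) \<le> 1" if "z \<in> ?W" for z
      using v[of z] W1 that by (auto simp: divide_simps)
    ultimately have "continuous_map (top_of_set ?W) (top_of_set ?D) (\<lambda>z. v z /\<^sub>R norm z)"
      by auto
    then have "continuous_map (top_of_set ?W) X (h2 \<circ> (\<lambda>z. v z /\<^sub>R norm z))"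
      by (rule continuous_map_compose[OF _ c2])
    moreover have "subtopology (top_of_set W) {z \<in> topspace (top_of_set W). 1 \<le> norm z} = top_of_set ?W"
      unfolding subtopology_subtopology by (rule arg_cong[of _ _ top_of_set]) auto
    ultimately show "continuous_map (subtopology (top_of_set W) {z \<in> topspace (top_of_set W). 1 \<le> norm z}) X
       (\<lambda>z. h2 (v z /\<^sub>R norm z))"
      by (simp add: o_def)
    show "h1 z = h2 (v z /\<^sub>R norm z)" if "z \<in> topspace (top_of_set W)" "norm z = 1" for z
      using that v[of z] sgn1[of z] by (auto simp: W_def)
  qed
  \<comment> \<open>Beyond the circle f has its values in the open second disc, which
    \<open>dis\<close> keeps apart from the closed first one; so only points on the same side can
    collide.\<close>
  have out: "f z \<in> h2 ` ball 0 1 \<and> f z = h2 (v z /\<^sub>R norm z) \<and> norm (v z /\<^sub>R norm z) = inverse (norm z) \<and>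
      v z /\<^sub>R norm z \<in> ?D"
    if "z \<in> W" "1 < norm z" for z
  proof -
    have "z \<in> W1" using that by (auto simp: W_def)
    then have n: "norm (v z /\<^sub>R norm z) = inverse (norm z)" using v[of z] by simp
    moreover have "inverse (norm z) < 1" using that(2) by (simp add: inverse_less_1_iff)
    moreover have "f z = h2 (v z /\<^sub>R norm z)" using that(2) by (simp add: f_def)
    ultimately show ?thesis by (auto simp del: norm_scaleR)
  qed
  have inn: "f z \<in> h1 ` ?D \<and> f z = h1 z" if "norm z \<le> 1" for z
    using that by (auto simp: f_def)
  have injf: "inj_on f W"
  proof (rule inj_onI)
    fix y z assume yz: "y \<in> W" "z \<in> W" "f y = f z"
    consider "norm y \<le> 1" "norm z \<le> 1" | "norm y \<le> 1" "1 < norm z"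
      | "1 < norm y" "norm z \<le> 1" | "1 < norm y" "1 < norm z" by linarith
    then show "y = z"
    proof cases
      case 1
      then show ?thesis using yz i1 by (simp add: inn inj_on_def)
    next
      case 2
      then show ?thesis using yz out[of z] inn[of y] dis by (metis disjoint_iff)
    next
      case 3
      then show ?thesis using yz out[of y] inn[of z] dis by (metis disjoint_iff)
    next
      case 4
      have W1: "y \<in> W1" "z \<in> W1" using 4 yz by (auto simp: W_def)
      \<comment> \<open>Comparing norms gives equal radii; what remains are equal
        directions.\<close>
      have eq: "v y /\<^sub>R norm y = v z /\<^sub>R norm z"
        using yz out[of y] out[of z] 4 i2 by (metis inj_onD)
      then have n: "norm y = norm z"
        using out[of y] out[of z] 4 yz by (metis inverse_inverse_eq)
      then have "v y = v z" using eq 4 by auto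
      then have "h1 (sgn y) = h1 (sgn z)" using v W1 by metis
      moreover have "sgn y \<in> ?D" "sgn z \<in> ?D" by (auto simp: norm_sgn)
      ultimately have "sgn y = sgn z" using i1 by (metis inj_onD)
      then show ?thesis using n 4 by (auto simp: sgn_div_norm)
    qed
  qed
  have "openin X (f ` W)"
    using open_image_plane[OF \<open>open W\<close> contf injf] .
  \<comment> \<open>The image of f contains only a sector of the second disc; the union with the
    open second disc supplies the rest.\<close>
  moreover have "openin X (h2 ` ball 0 1)"
    by (rule open_image_plane[OF open_ball continuous_map_from_subtopology_mono[OF c2 ball_subset_cball]
        inj_on_subset[OF i2 ball_subset_cball]])
  ultimately have "openin X (f ` W \<union> h2 ` ball 0 1)" by blast
  moreover have "f ` W \<union> h2 ` ball 0 1 = h1 ` ball 0 1 \<union> h1 ` A \<union> h2 ` ball 0 1"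
  proof (intro equalityI subsetI)
    fix x assume "x \<in> f ` W \<union> h2 ` ball 0 1"
    moreover have "f z \<in> h1 ` ball 0 1 \<union> h1 ` A \<union> h2 ` ball 0 1" if "z \<in> W" for z
    proof (cases "norm z \<le> 1")
      case True
      then have "z \<in> ball 0 1 \<union> A"
        using that sgnA[of z] sgn1[of z] by (fastforce simp: W_def)
      then show ?thesis using inn[OF True] by auto
    next
      case False
      then show ?thesis using out[of z] that by auto
    qed
    ultimately show "x \<in> h1 ` ball 0 1 \<union> h1 ` A \<union> h2 ` ball 0 1" by blast
  next
    fix x assume "x \<in> h1 ` ball 0 1 \<union> h1 ` A \<union> h2 ` ball 0 1"
    moreover have "h1 z \<in> f ` W" if "z \<in> ball 0 1 \<union> A" for z
    proof -
      have "norm z \<le> 1" "z \<in> W"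
        using that T sgn1[of z] by (auto simp: W_def W1_def)
      then show ?thesis using inn[of z] by (metis imageI)
    qed
    ultimately show "x \<in> f ` W \<union> h2 ` ball 0 1" by blast
  qed
  ultimately show ?thesis by simp
qed

end

section \<open>Triangulated surfaces\<close>

lemma ball_union_sphere: "ball a r \<union> sphere a r = cball a r"
  by auto

locale triangulation = sphere_cover X q d for X :: "'a topology" and q and d +
  fixes V :: "'v set" and E :: "'v set set" and pt :: "'v \<Rightarrow> 'a" and curve :: "'v set \<Rightarrow> 'a set"
  assumes tri: "triangular_embedding X V E pt curve"
begin

abbreviation "\<F> \<equiv> faces X V E pt curve"
abbreviation "graph_points \<equiv> pt ` V \<union> \<Union> (curve ` E)"
abbreviation "fv \<equiv> face_vertices X V pt"
abbreviation "open_edge e \<equiv> curve e - pt ` V"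

section \<open>Vertices, edges and faces as point sets\<close>

lemma emb: "embedded_graph X V E pt curve"
  using tri by (simp add: triangular_embedding_def)

lemma finite_V: "finite V" and finite_E: "finite E" and E2: "e \<in> E \<Longrightarrow> e \<subseteq> V \<and> card e = 2"
proof -
  show fin: "finite V" and "e \<in> E \<Longrightarrow> e \<subseteq> V \<and> card e = 2"
    using emb by (auto simp: embedded_graph_def simple_graph_def)
  have "E \<subseteq> Pow V" using emb by (auto simp: embedded_graph_def simple_graph_def)
  then show "finite E" using fin by (meson finite_Pow_iff finite_subset)
qed

lemma inj_pt: "inj_on pt V" and pt_X: "pt ` V \<subseteq> topspace X"
  using emb by (auto simp: embedded_graph_def)

lemma curve_arc:
  assumes "e \<in> E"
  obtains g where "embedding_map (top_of_set {0..1::real}) X g" "{g 0, g 1} = pt ` e" "g ` {0..1} = curve e"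
proof -
  have "\<exists>g. embedding_map (top_of_set {0..1::real}) X g \<and> {g 0, g 1} = pt ` e \<and> g ` {0..1} = curve e"
    using emb assms by (simp add: embedded_graph_def)
  then show thesis using that by blast
qed

lemma curve_pt: "e \<in> E \<Longrightarrow> curve e \<inter> pt ` V = pt ` e"
  using emb by (auto simp: embedded_graph_def)

lemma curve_curve: "e \<in> E \<Longrightarrow> e' \<in> E \<Longrightarrow> e \<noteq> e' \<Longrightarrow> curve e \<inter> curve e' = pt ` (e \<inter> e')"
  using emb by (simp add: embedded_graph_def)

lemma curve_curve_pt: "e \<in> E \<Longrightarrow> e' \<in> E \<Longrightarrow> e \<noteq> e' \<Longrightarrow> curve e \<inter> curve e' \<subseteq> pt ` V"
  using curve_curve[of e e'] E2[of e] by blast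

lemma pt_in_curve: "e \<in> E \<Longrightarrow> v \<in> V \<Longrightarrow> pt v \<in> curve e \<longleftrightarrow> v \<in> e"
proof -
  assume e: "e \<in> E" and v: "v \<in> V"
  have "pt v \<in> curve e \<longleftrightarrow> pt v \<in> pt ` e" using curve_pt[OF e] v by blast
  also have "\<dots> \<longleftrightarrow> v \<in> e" using inj_on_image_mem_iff[OF inj_pt v] E2[OF e] by blast
  finally show ?thesis .
qed

lemma closedin_curve: "e \<in> E \<Longrightarrow> closedin X (curve e)"
proof -
  assume "e \<in> E"
  then obtain g where g: "embedding_map (top_of_set {0..1::real}) X g" "g ` {0..1} = curve e"
    by (rule curve_arc) blast
  then have "continuous_map (top_of_set {0..1}) X g" by (metis embedding_mapD)
  then have "compactin X (g ` {0..1})"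
    by (rule image_compactin[rotated]) (simp add: compactin_subtopology)
  then show ?thesis using g haus compactin_imp_closedin by metis
qed

lemma closedin_other_curves: "closedin X (pt ` V \<union> \<Union> (curve ` (E - {e})))"
proof -
  have "closedin X (pt ` V)"
    using finite_V pt_X by (simp add: closedin_Hausdorff_finite[OF haus])
  moreover have "closedin X (\<Union> (curve ` (E - {e})))"
    using finite_E closedin_curve by (intro closedin_Union) auto
  ultimately show ?thesis by blast
qed

lemma inner_nonempty: "e \<in> E \<Longrightarrow> open_edge e \<noteq> {}"
proof -
  assume e: "e \<in> E"
  then obtain g where g: "embedding_map (top_of_set {0..1::real}) X g" "{g 0, g 1} = pt ` e" "g ` {0..1} = curve e"
    by (rule curve_arc) blast
  have inj: "inj_on g {0..1}" using embedding_mapD[OF g(1)] by metis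
  have "g (1/2) \<in> curve e" using g(3) by force
  moreover have "g (1/2) \<noteq> g 0" "g (1/2) \<noteq> g 1"
    using inj_onD[OF inj, of "1/2" 0] inj_onD[OF inj, of "1/2" 1] by auto
  then have "g (1/2) \<notin> pt ` e" using g(2) by auto
  ultimately show ?thesis using curve_pt[OF e] by blast
qed

lemma faces_disjoint: "F \<in> \<F> \<Longrightarrow> F' \<in> \<F> \<Longrightarrow> F \<noteq> F' \<Longrightarrow> F \<inter> F' = {}"
  unfolding faces_def using pairwise_disjoint_connected_components_of
  by (metis disjnt_def pairwiseD)

lemma Union_faces: "\<Union> \<F> = topspace X - graph_points"
  unfolding faces_def Union_connected_components_of by auto

text \<open>Trades the corners a, b, c for the symmetric description by \<open>fv F\<close>. The
  closure of F is the compact image of the closed disc, so the vertices found there are exactly the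
  corners, and every pair of corners is one of the three boundary edges.\<close>

lemma face_disc:
  assumes "F \<in> \<F>"
  obtains h where "embedding_map (top_of_set (cball (0 :: real^2) 1)) X h" "h ` ball 0 1 = F"
    "h ` sphere 0 1 = \<Union> (curve ` {e \<in> E. e \<subseteq> fv F})" "X closure_of F = h ` cball 0 1"
    "card (fv F) = 3" "\<And>e. e \<subseteq> fv F \<Longrightarrow> card e = 2 \<Longrightarrow> e \<in> E"
proof -
  have "triangular_face X E curve F"
    using tri assms by (auto simp: triangular_embedding_def)
  then obtain a b c h where abc: "a \<noteq> b" "b \<noteq> c" "c \<noteq> a" and abcE: "{a, b} \<in> E" "{b, c} \<in> E" "{c, a} \<in> E"
    and h: "embedding_map (top_of_set (cball (0 :: real^2) 1)) X h" "h ` ball 0 1 = F"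
      "h ` sphere 0 1 = curve {a, b} \<union> curve {b, c} \<union> curve {c, a}"
    unfolding triangular_face_def by (elim exE conjE)
  have abcV: "{a, b, c} \<subseteq> V" using E2[OF abcE(1)] E2[OF abcE(2)] by blast
  have conth: "continuous_map (top_of_set (cball 0 1)) X h" using embedding_mapD[OF h(1)] by metis
  then have "compactin X (h ` cball 0 1)"
    by (rule image_compactin[rotated]) (simp add: compactin_subtopology)
  then have clo: "closedin X (h ` cball 0 1)" using haus compactin_imp_closedin by metis
  have cl: "X closure_of F = h ` cball 0 1"
  proof
    show "X closure_of F \<subseteq> h ` cball 0 1"
      using clo h(2) by (intro closure_of_minimal) (auto intro!: image_mono ball_subset_cball)
    have "top_of_set (cball 0 1) closure_of ball 0 1 = (cball 0 1 :: (real^2) set)"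
      by (simp add: closure_of_subtopology Int_absorb1 ball_subset_cball)
    then show "h ` cball 0 1 \<subseteq> X closure_of F"
      using continuous_map_image_closure_subset[OF conth, of "ball 0 1"] h(2) by simp
  qed
  have cb: "h ` cball 0 1 = F \<union> (curve {a, b} \<union> curve {b, c} \<union> curve {c, a})"
    unfolding h(2)[symmetric] h(3)[symmetric] image_Un[symmetric] by (simp add: ball_union_sphere)
  have FG: "F \<inter> pt ` V = {}" using Union_faces assms by blast
  have fv: "fv F = {a, b, c}"
  proof -
    have "pt v \<in> h ` cball 0 1 \<longleftrightarrow> v \<in> {a, b, c}" if "v \<in> V" for v
    proof -
      have "pt v \<notin> F" using FG that by blast
      then show ?thesis using cb pt_in_curve[OF _ that] abcE by auto
    qed
    then show ?thesis unfolding face_vertices_def cl using abcV by auto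
  qed
  have sub: "e \<in> {{a, b}, {b, c}, {c, a}}" if "e \<subseteq> {a, b, c}" "card e = 2" for e
  proof -
    obtain x y where "e = {x, y}" "x \<noteq> y" using \<open>card e = 2\<close> by (auto simp: card_2_iff)
    then show ?thesis using that(1) by auto
  qed
  have "{e \<in> E. e \<subseteq> fv F} = {{a, b}, {b, c}, {c, a}}"
    unfolding fv using sub E2 abcE by auto
  then have "h ` sphere 0 1 = \<Union> (curve ` {e \<in> E. e \<subseteq> fv F})" using h(3) by auto
  moreover have "card (fv F) = 3" using fv abc by simp
  moreover have "\<And>e. e \<subseteq> fv F \<Longrightarrow> card e = 2 \<Longrightarrow> e \<in> E" using sub abcE unfolding fv by blast
  ultimately show thesis using that h cl by blast
qed

lemma face_closure:
  assumes "F \<in> \<F>"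
  shows "X closure_of F = F \<union> \<Union> (curve ` {e \<in> E. e \<subseteq> fv F})"
proof -
  obtain h where h: "h ` ball 0 1 = F" "h ` sphere 0 1 = \<Union> (curve ` {e \<in> E. e \<subseteq> fv F})"
    "X closure_of F = h ` cball (0 :: real^2) 1"
    by (rule face_disc[OF assms]) blast
  have "h ` cball 0 1 = h ` ball 0 1 \<union> h ` sphere 0 1"
    unfolding image_Un[symmetric] ball_union_sphere ..
  then show ?thesis unfolding h .
qed

lemma card_fv: "F \<in> \<F> \<Longrightarrow> card (fv F) = 3"
  by (rule face_disc)

lemma fv_edge: "F \<in> \<F> \<Longrightarrow> e \<subseteq> fv F \<Longrightarrow> card e = 2 \<Longrightarrow> e \<in> E"
  by (rule face_disc) blast+

lemma fv_V: "fv F \<subseteq> V"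
  by (auto simp: face_vertices_def)

lemma face_not_graph: "F \<in> \<F> \<Longrightarrow> F \<inter> graph_points = {}"
  using Union_faces by blast

section \<open>The faces at an edge\<close>

lemma open_edge_closure:
  assumes "e \<in> E" "F \<in> \<F>"
  shows "e \<subseteq> fv F \<Longrightarrow> open_edge e \<subseteq> X closure_of F"
    and "\<not> e \<subseteq> fv F \<Longrightarrow> open_edge e \<inter> X closure_of F = {}"
proof -
  show "open_edge e \<subseteq> X closure_of F" if "e \<subseteq> fv F"
    unfolding face_closure[OF assms(2)] using assms that by blast
  show "open_edge e \<inter> X closure_of F = {}" if "\<not> e \<subseteq> fv F"
  proof -
    have "open_edge e \<inter> F = {}" using face_not_graph[OF assms(2)] assms(1) by blast
    moreover have "open_edge e \<inter> curve e' = {}" if "e' \<in> E" "e' \<subseteq> fv F" for e'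
      using curve_curve_pt[OF assms(1) that(1)] that \<open>\<not> e \<subseteq> fv F\<close> by blast
    ultimately show ?thesis unfolding face_closure[OF assms(2)] by blast
  qed
qed

text \<open>The part A of the first circle lying over the open edge is obtained by removing the
  closed set of all vertices and other curves. It is therefore open in the circle, and the discs can
  be glued along it.\<close>

lemma open_face_edge_face:
  assumes e: "e \<in> E" "e \<subseteq> fv F1" "e \<subseteq> fv F2" and F: "F1 \<in> \<F>" "F2 \<in> \<F>" "F1 \<noteq> F2"
  shows "openin X (F1 \<union> open_edge e \<union> F2)"
proof -
  obtain h1 where h1: "embedding_map (top_of_set (cball (0 :: real^2) 1)) X h1" "h1 ` ball 0 1 = F1"
    "h1 ` sphere 0 1 = \<Union> (curve ` {e \<in> E. e \<subseteq> fv F1})" "X closure_of F1 = h1 ` cball 0 1"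
    by (rule face_disc[OF F(1)]) blast
  obtain h2 where h2: "embedding_map (top_of_set (cball (0 :: real^2) 1)) X h2" "h2 ` ball 0 1 = F2"
    "h2 ` sphere 0 1 = \<Union> (curve ` {e \<in> E. e \<subseteq> fv F2})"
    by (rule face_disc[OF F(2)]) blast
  let ?C = "pt ` V \<union> \<Union> (curve ` (E - {e}))"
  have oe: "open_edge e = curve e - ?C"
    using curve_curve_pt[OF e(1)] by blast
  have c1: "continuous_map (top_of_set (cball 0 1)) X h1"
    using embedding_mapD[OF h1(1)] by metis
  have c1s: "continuous_map (top_of_set (sphere 0 1)) X h1"
    by (rule continuous_map_from_subtopology_mono[OF c1 sphere_cball])
  define A where "A = {z \<in> sphere (0 :: real^2) 1. h1 z \<in> topspace X - ?C}"
  have opA: "openin (top_of_set (sphere 0 1)) A"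
    unfolding A_def
    using openin_continuous_map_preimage[OF c1s openin_diff[OF openin_topspace closedin_other_curves]] by simp
  have "h1 ` A \<subseteq> open_edge e"
  proof
    fix x assume "x \<in> h1 ` A"
    then have x: "x \<in> h1 ` sphere 0 1" "x \<notin> ?C" by (auto simp: A_def)
    then obtain e' where "e' \<in> E" "x \<in> curve e'" using h1(3) by auto
    then have "x \<in> curve e" using x(2) by (cases "e' = e") auto
    then show "x \<in> open_edge e" using x(2) by auto
  qed
  moreover have "open_edge e \<subseteq> h1 ` A"
  proof
    fix x assume x: "x \<in> open_edge e"
    then have "x \<in> h1 ` sphere 0 1" unfolding h1(3) using e by auto
    moreover have "x \<in> topspace X"
      using x closedin_subset[OF closedin_curve[OF e(1)]] by auto
    moreover have "x \<notin> ?C" using x oe by auto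
    ultimately show "x \<in> h1 ` A" unfolding A_def by auto
  qed
  ultimately have A: "h1 ` A = open_edge e" by blast
  have "h1 ` cball 0 1 \<inter> h2 ` ball 0 1 = {}"
    unfolding h1(4)[symmetric] h2(2) face_closure[OF F(1)]
    using face_not_graph[OF F(2)] faces_disjoint[OF F] by blast
  moreover have "h1 ` A \<subseteq> h2 ` sphere 0 1" unfolding A h2(3) using e by blast
  ultimately show ?thesis
    using glued_discs_open[OF h1(1) h2(1) _ opA] A h1(2) h2(2) by auto
qed

text \<open>Two faces together with the open edge already form a neighbourhood of an inner point of
  the edge, so this point cannot be in the closure of a third face.\<close>

lemma edge_not_three_faces:
  assumes e: "e \<in> E" "e \<subseteq> fv F1" "e \<subseteq> fv F2" "e \<subseteq> fv F3"
    and F: "F1 \<in> \<F>" "F2 \<in> \<F>" "F3 \<in> \<F>" "F1 \<noteq> F2" "F1 \<noteq> F3" "F2 \<noteq> F3"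
  shows False
proof -
  obtain p where p: "p \<in> open_edge e" using inner_nonempty[OF e(1)] by blast
  then have "p \<in> X closure_of F3" using open_edge_closure(1)[OF e(1) F(3) e(4)] by blast
  then have "\<And>T. p \<in> T \<Longrightarrow> openin X T \<Longrightarrow> \<exists>y. y \<in> F3 \<and> y \<in> T"
    by (simp add: in_closure_of)
  from this[OF _ open_face_edge_face[OF e(1-3) F(1,2,4)]]
  have "\<exists>y. y \<in> F3 \<and> y \<in> F1 \<union> open_edge e \<union> F2" using p by simp
  moreover have "F3 \<inter> (F1 \<union> open_edge e \<union> F2) = {}"
    using faces_disjoint[OF F(1,3,5)] faces_disjoint[OF F(2,3,6)] face_not_graph[OF F(3)] e(1) by blast
  ultimately show False by blast
qed

text \<open>As \<open>card\<close> is 0 on infinite sets, the bound alone would say nothing about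
  finiteness; excluding three-element subsets gives both.\<close>

lemma edge_faces_le_two:
  assumes "e \<in> E"
  shows "finite {F \<in> \<F>. e \<subseteq> fv F}" "card {F \<in> \<F>. e \<subseteq> fv F} \<le> 2"
proof -
  let ?S = "{F \<in> \<F>. e \<subseteq> fv F}"
  have no3: "\<not> (\<exists>B\<subseteq>?S. card B = 3)"
  proof
    assume "\<exists>B\<subseteq>?S. card B = 3"
    then obtain B where B: "B \<subseteq> ?S" "card B = 3" by blast
    then obtain F1 F2 F3 where "B = {F1, F2, F3}" "F1 \<noteq> F2" "F1 \<noteq> F3" "F2 \<noteq> F3"
      using card_3_iff[of B] by auto
    then show False using B(1) edge_not_three_faces[OF assms, of F1 F2 F3] by auto
  qed
  show "finite ?S"
    using no3 infinite_arbitrarily_large[of ?S 3] by blast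
  show "card ?S \<le> 2"
  proof (rule ccontr)
    assume "\<not> card ?S \<le> 2"
    then have "3 \<le> card ?S" by simp
    then obtain B where "B \<subseteq> ?S" "card B = 3" by (rule obtain_subset_with_card_n)
    then show False using no3 by blast
  qed
qed

lemma finite_faces: "finite \<F>"
proof -
  have "\<F> \<subseteq> (\<Union>e\<in>E. {F \<in> \<F>. e \<subseteq> fv F})"
  proof
    fix F assume F: "F \<in> \<F>"
    obtain e where "e \<subseteq> fv F" "card e = 2"
      using card_fv[OF F] obtain_subset_with_card_n[of 2 "fv F"] by auto
    then show "F \<in> (\<Union>e\<in>E. {F \<in> \<F>. e \<subseteq> fv F})" using fv_edge[OF F] F by blast
  qed
  then show ?thesis
    using finite_E edge_faces_le_two(1) by (meson finite_UN_I finite_subset)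
qed

text \<open>Around an inner point p of the edge X would otherwise look wrong: with no face at the
  edge a neighbourhood of p would lie on an arc, and with a single face it would lie in a closed
  disc with p on the boundary.\<close>

lemma edge_two_faces:
  assumes e: "e \<in> E"
  obtains F1 F2 where "F1 \<in> \<F>" "F2 \<in> \<F>" "F1 \<noteq> F2" "e \<subseteq> fv F1" "e \<subseteq> fv F2"
proof (rule ccontr)
  assume "\<not> thesis"
  then have one: "F1 = F2" if "F1 \<in> \<F>" "F2 \<in> \<F>" "e \<subseteq> fv F1" "e \<subseteq> fv F2" for F1 F2
    using that by (metis \<open>\<And>F1 F2. \<lbrakk>F1 \<in> \<F>; F2 \<in> \<F>; F1 \<noteq> F2; e \<subseteq> fv F1; e \<subseteq> fv F2\<rbrakk> \<Longrightarrow> thesis\<close>)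
  obtain p where p: "p \<in> open_edge e" using inner_nonempty[OF e] by blast
  \<comment> \<open>Everything that stays away from p is removed: vertices, other curves, and
    closures of the faces not at e. Finiteness of the set of faces makes N open.\<close>
  define N where "N = topspace X - (pt ` V \<union> \<Union> (curve ` (E - {e}))) - \<Union> ((closure_of) X ` {F \<in> \<F>. \<not> e \<subseteq> fv F})"
  have "closedin X (\<Union> ((closure_of) X ` {F \<in> \<F>. \<not> e \<subseteq> fv F}))"
    using finite_faces by (intro closedin_Union) auto
  then have opN: "openin X N"
    unfolding N_def by (intro openin_diff closedin_other_curves) auto
  have pX: "p \<in> topspace X" using p closedin_subset[OF closedin_curve[OF e]] by blast
  have pN: "p \<in> N"
    using p pX curve_curve_pt[OF e] open_edge_closure(2)[OF e] unfolding N_def by blast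
  have NF: "x \<in> open_edge e \<or> (\<exists>F\<in>\<F>. e \<subseteq> fv F \<and> x \<in> F)" if "x \<in> N" for x
  proof (cases "x \<in> graph_points")
    case True
    then show ?thesis using that unfolding N_def by blast
  next
    case False
    moreover have "x \<in> topspace X" using that by (simp add: N_def)
    ultimately have "x \<in> \<Union> \<F>" unfolding Union_faces by simp
    then obtain F where F: "F \<in> \<F>" "x \<in> F" by auto
    then have "x \<in> X closure_of F" using face_closure[OF F(1)] by simp
    then have "e \<subseteq> fv F" using F(1) that unfolding N_def by auto
    then show ?thesis using F by auto
  qed
  show False
  proof (cases "\<exists>F\<in>\<F>. e \<subseteq> fv F")
    case False
    then have sub: "N \<subseteq> curve e" using NF by blast
    obtain g where g: "embedding_map (top_of_set {0..1::real}) X g" "g ` {0..1} = curve e"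
      by (rule curve_arc[OF e]) blast
    obtain k where k: "continuous_map (subtopology X (g ` {0..1})) (top_of_set {0..1}) k" "\<And>z. z \<in> {0..1} \<Longrightarrow> k (g z) = z"
      using embedding_mapD[OF g(1)] by metis
    have "continuous_map (subtopology X N) euclidean k"
      using k(1) sub g(2) by (metis continuous_map_from_subtopology_mono continuous_map_in_subtopology)
    moreover have "g (k x) = x" if "x \<in> N" for x
    proof -
      have "x \<in> g ` {0..1}" using that sub g(2) by auto
      then show ?thesis using k(2) by auto
    qed
    then have "inj_on k N" by (rule inj_on_inverseI)
    ultimately show False using continuous_inj_to_real[OF opN] pN by blast
  next
    case True
    then obtain F where F: "F \<in> \<F>" "e \<subseteq> fv F" by blast
    obtain h where h: "embedding_map (top_of_set (cball (0 :: real^2) 1)) X h" "h ` ball 0 1 = F"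
      "h ` sphere 0 1 = \<Union> (curve ` {e \<in> E. e \<subseteq> fv F})" "X closure_of F = h ` cball 0 1"
      by (rule face_disc[OF F(1)]) blast
    have sub: "N \<subseteq> h ` cball 0 1"
    proof
      fix x assume "x \<in> N"
      then have "x \<in> open_edge e \<or> x \<in> F" using NF[of x] one F by blast
      then show "x \<in> h ` cball 0 1"
        using open_edge_closure(1)[OF e F] face_closure[OF F(1)] unfolding h(4)[symmetric] by blast
    qed
    obtain k where k: "continuous_map (subtopology X (h ` cball 0 1)) (top_of_set (cball 0 1)) k"
      "\<And>z. z \<in> cball 0 1 \<Longrightarrow> k (h z) = z"
      using embedding_mapD[OF h(1)] by metis
    have "continuous_map (subtopology X N) euclidean k"
      using k(1) sub by (metis continuous_map_from_subtopology_mono continuous_map_in_subtopology)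
    moreover have hk: "h (k x) = x \<and> k x \<in> cball 0 1" if "x \<in> N" for x
    proof -
      have "x \<in> h ` cball 0 1" using that sub by auto
      then obtain z where "z \<in> cball 0 1" "x = h z" by auto
      then show ?thesis using k(2)[of z] by simp
    qed
    then have "inj_on k N" by (metis inj_on_inverseI)
    ultimately have "open (k ` N)" using open_image_chart[OF opN] by simp
    moreover have "k ` N \<subseteq> cball 0 1" using hk by blast
    \<comment> \<open>An open subset of the closed disc avoids the boundary circle, where p is
      mapped.\<close>
    ultimately have "k ` N \<subseteq> ball 0 1" using interior_maximal[of "k ` N" "cball 0 1"] by simp
    moreover obtain z where z: "z \<in> sphere 0 1" "p = h z" using p h(3) e F by blast
    then have "k p = z" using k(2)[of z] by simp
    ultimately show False using z pN by auto
  qed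
qed

text \<open>Connectedness of the graph comes from that of X. If no edge left U, every edge and every
  face would have its vertices on one side, and X would be the disjoint union of two nonempty closed
  sets.\<close>

lemma edge_leaves_vertex_set:
  assumes U: "U \<subseteq> V" "U \<noteq> {}" "U \<noteq> V"
  shows "\<exists>u\<in>U. \<exists>w\<in>V - U. {u, w} \<in> E"
proof (rule ccontr)
  assume no: "\<not> ?thesis"
  have mono: "S \<subseteq> U \<or> S \<subseteq> V - U" if "S \<subseteq> V" "\<And>x y. x \<in> S \<Longrightarrow> y \<in> S \<Longrightarrow> x \<noteq> y \<Longrightarrow> {x, y} \<in> E" for S
    using no that by blast
  have edge: "e \<subseteq> U \<or> e \<subseteq> V - U" if e: "e \<in> E" for e
  proof -
    obtain x y where xy: "e = {x, y}" using E2[OF e] by (auto simp: card_2_iff)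
    moreover have "{y, x} \<in> E" using xy e by (simp add: insert_commute)
    ultimately show ?thesis
      using no e E2[OF e] by (cases "x \<in> U"; cases "y \<in> U") auto
  qed
  have face: "fv F \<subseteq> U \<or> fv F \<subseteq> V - U" if F: "F \<in> \<F>" for F
    by (rule mono[OF fv_V fv_edge[OF F]]) (auto simp: card_insert_if)
  define S where "S = (\<lambda>W. pt ` W \<union> \<Union> (curve ` {e \<in> E. e \<subseteq> W}) \<union> \<Union> ((closure_of) X ` {F \<in> \<F>. fv F \<subseteq> W}))"
  have S_closed: "closedin X (S W)" if "W \<subseteq> V" for W
  proof -
    have "closedin X (pt ` W)"
      using finite_V pt_X that by (intro closedin_Hausdorff_finite[OF haus]) (auto intro: finite_subset)
    moreover have "closedin X (\<Union> (curve ` {e \<in> E. e \<subseteq> W}))"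
      using finite_E closedin_curve by (intro closedin_Union) auto
    moreover have "closedin X (\<Union> ((closure_of) X ` {F \<in> \<F>. fv F \<subseteq> W}))"
      using finite_faces by (intro closedin_Union) auto
    ultimately show ?thesis unfolding S_def by blast
  qed
  \<comment> \<open>The definition with closures yields closedness; this form, with the bare faces,
    yields disjointness.\<close>
  have S_eq: "S W = pt ` W \<union> \<Union> (curve ` {e \<in> E. e \<subseteq> W}) \<union> \<Union> {F \<in> \<F>. fv F \<subseteq> W}" for W
    unfolding S_def using face_closure by fastforce
  have "S U \<inter> S (V - U) = {}"
  proof -
    have 1: "pt ` U \<inter> pt ` (V - U) = {}"
      using inj_pt U(1) by (auto simp: inj_on_def)
    have 2: "pt ` W \<inter> curve e = {}" if "e \<in> E" "W \<subseteq> V" "W \<inter> e = {}" for W e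
      using that pt_in_curve[OF that(1)] by blast
    have 3: "curve e \<inter> curve e' = {}" if "e \<in> E" "e' \<in> E" "e \<subseteq> U" "e' \<subseteq> V - U" for e e'
    proof -
      have "e \<inter> e' = {}" using that by blast
      moreover have "e \<noteq> {}" using E2[OF that(1)] by auto
      ultimately show ?thesis using curve_curve[OF that(1,2)] by auto
    qed
    have 4: "F \<inter> F' = {}" if "F \<in> \<F>" "F' \<in> \<F>" "fv F \<subseteq> U" "fv F' \<subseteq> V - U" for F F'
    proof -
      have "fv F \<noteq> {}" using card_fv[OF that(1)] by auto
      then have "F \<noteq> F'" using that by blast
      then show ?thesis using faces_disjoint that by blast
    qed
    have gen: "(A \<union> B \<union> C) \<inter> (A' \<union> B' \<union> C') = {}"
      if "A \<inter> A' = {}" "A \<inter> B' = {}" "A' \<inter> B = {}" "B \<inter> B' = {}" "C \<inter> C' = {}"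
        "A \<union> B \<subseteq> G" "A' \<union> B' \<subseteq> G" "C \<inter> G = {}" "C' \<inter> G = {}" for A B C A' B' C' G :: "'a set"
      using that by blast
    have gen2: "\<Union> (g ` A) \<inter> \<Union> (g ` B) = {}"
      if "\<And>a b. a \<in> A \<Longrightarrow> b \<in> B \<Longrightarrow> g a \<inter> g b = {}" for A B and g :: "'i \<Rightarrow> 'a set"
      using that by blast
    have 5: "\<Union> {F \<in> \<F>. fv F \<subseteq> W} \<inter> graph_points = {}" for W
      using face_not_graph by blast
    have 6: "pt ` W \<union> \<Union> (curve ` {e \<in> E. e \<subseteq> W}) \<subseteq> graph_points" if "W \<subseteq> V" for W
      using that by blast
    have 7: "pt ` W \<inter> \<Union> (curve ` {e \<in> E. e \<subseteq> W'}) = {}" if "W \<subseteq> V" "W \<inter> W' = {}" for W W'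
    proof -
      have "pt ` W \<inter> curve e = {}" if "e \<in> E" "e \<subseteq> W'" for e
        by (rule 2) (use that \<open>W \<subseteq> V\<close> \<open>W \<inter> W' = {}\<close> in auto)
      then show ?thesis by auto
    qed
    show ?thesis
      unfolding S_eq
    proof (rule gen[OF 1 _ _ _ _ 6 6 5 5])
      show "pt ` U \<inter> \<Union> (curve ` {e \<in> E. e \<subseteq> V - U}) = {}"
        "pt ` (V - U) \<inter> \<Union> (curve ` {e \<in> E. e \<subseteq> U}) = {}"
        using U(1) by (intro 7; auto)+
      show "\<Union> (curve ` {e \<in> E. e \<subseteq> U}) \<inter> \<Union> (curve ` {e \<in> E. e \<subseteq> V - U}) = {}"
        by (rule gen2) (use 3 in auto)
      show "\<Union> {F \<in> \<F>. fv F \<subseteq> U} \<inter> \<Union> {F \<in> \<F>. fv F \<subseteq> V - U} = {}"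
        using gen2[of "{F \<in> \<F>. fv F \<subseteq> U}" "{F \<in> \<F>. fv F \<subseteq> V - U}" "\<lambda>F. F"] 4 by simp
    qed (use U(1) in auto)
  qed
  moreover have "S U \<union> S (V - U) = topspace X"
  proof
    show "S U \<union> S (V - U) \<subseteq> topspace X"
      using S_closed[of U] S_closed[of "V - U"] U(1) closedin_subset by (metis Diff_subset Un_least)
    have cover: "A \<subseteq> T \<Longrightarrow> B \<subseteq> T \<Longrightarrow> Y - (A \<union> B) \<subseteq> T \<Longrightarrow> Y \<subseteq> T" for A B T Y :: "'a set"
      by blast
    have "pt ` V \<subseteq> S U \<union> S (V - U)"
      unfolding S_eq by auto
    moreover have "curve e \<subseteq> S U \<union> S (V - U)" if "e \<in> E" for e
      using edge[OF that] that unfolding S_eq by auto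
    then have "\<Union> (curve ` E) \<subseteq> S U \<union> S (V - U)" by auto
    moreover have "F \<subseteq> S U \<union> S (V - U)" if "F \<in> \<F>" for F
      using face[OF that] that unfolding S_eq by auto
    then have "topspace X - graph_points \<subseteq> S U \<union> S (V - U)"
      unfolding Union_faces[symmetric] by auto
    ultimately show "topspace X \<subseteq> S U \<union> S (V - U)" by (rule cover)
  qed
  moreover have "S U \<noteq> {}" "S (V - U) \<noteq> {}"
    unfolding S_def using U by blast+
  ultimately show False
    using connected_X S_closed[of U] S_closed[of "V - U"] U(1)
    unfolding connected_space_closedin_eq by (metis Diff_subset)
qed

text \<open>Two faces with the same vertices have the same boundary circle. Glued along all of it
  they form a set that is open and closed, hence all of X, and then only three vertices
  exist.\<close>

lemma inj_on_fv:
  assumes "4 \<le> card V"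
  shows "inj_on fv \<F>"
proof (rule inj_onI, rule ccontr)
  fix F1 F2 assume F: "F1 \<in> \<F>" "F2 \<in> \<F>" "fv F1 = fv F2" "F1 \<noteq> F2"
  obtain h1 where h1: "embedding_map (top_of_set (cball (0 :: real^2) 1)) X h1" "h1 ` ball 0 1 = F1"
    "h1 ` sphere 0 1 = \<Union> (curve ` {e \<in> E. e \<subseteq> fv F1})" "X closure_of F1 = h1 ` cball 0 1"
    by (rule face_disc[OF F(1)]) blast
  obtain h2 where h2: "embedding_map (top_of_set (cball (0 :: real^2) 1)) X h2" "h2 ` ball 0 1 = F2"
    "h2 ` sphere 0 1 = \<Union> (curve ` {e \<in> E. e \<subseteq> fv F2})"
    by (rule face_disc[OF F(2)]) blast
  let ?S = "F1 \<union> h1 ` sphere 0 1 \<union> F2"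
  have "h1 ` cball 0 1 \<inter> h2 ` ball 0 1 = {}"
    unfolding h1(4)[symmetric] h2(2) face_closure[OF F(1)]
    using face_not_graph[OF F(2)] faces_disjoint[OF F(1,2,4)] by blast
  then have "openin X ?S"
    using glued_discs_open[OF h1(1) h2(1), of "sphere 0 1"] h1(2,3) h2(2,3) F(3) by simp
  moreover have "?S = X closure_of F1 \<union> X closure_of F2"
    unfolding face_closure[OF F(1)] face_closure[OF F(2)] h1(3) F(3) by blast
  then have "closedin X ?S" by (simp add: closedin_Un)
  moreover have "F1 \<noteq> {}" using h1(2) by auto
  ultimately have S: "?S = topspace X"
    using connected_X unfolding connected_space_clopen_in by blast
  have "V \<subseteq> fv F1"
  proof
    fix v assume v: "v \<in> V"
    then have "pt v \<in> ?S" using S pt_X by blast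
    moreover have "pt v \<notin> F1" "pt v \<notin> F2" using face_not_graph F(1,2) v by blast+
    ultimately show "v \<in> fv F1" using h1(3) pt_in_curve[OF _ v] by blast
  qed
  then have "card V \<le> 3" using card_fv[OF F(1)] by (metis card_mono card.infinite finite_V finite_subset fv_V)
  then show False using assms by simp
qed


text \<open>Double counting of incidences between edges and faces.\<close>

lemma three_faces_le_two_edges: "3 * card \<F> \<le> 2 * card E"
proof -
  have three: "card {e \<in> E. e \<subseteq> fv F} = 3" if F: "F \<in> \<F>" for F
  proof -
    have "{e \<in> E. e \<subseteq> fv F} = {e. e \<subseteq> fv F \<and> card e = 2}"
      using E2 fv_edge[OF F] by auto
    moreover have "finite (fv F)" using finite_subset[OF fv_V finite_V] .
    ultimately show ?thesis
      using n_subsets[of "fv F" 2] card_fv[OF F] by (simp add: choose_two)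
  qed
  have "3 * card \<F> = (\<Sum>F\<in>\<F>. card {e \<in> E. e \<subseteq> fv F})"
    using three by simp
  also have "\<dots> = (\<Sum>F\<in>\<F>. \<Sum>e\<in>E. if e \<subseteq> fv F then 1 else 0)"
    using finite_E by (simp add: sum.If_cases Int_def)
  also have "\<dots> = (\<Sum>e\<in>E. \<Sum>F\<in>\<F>. if e \<subseteq> fv F then 1 else 0)"
    by (rule sum.swap)
  also have "\<dots> = (\<Sum>e\<in>E. card {F \<in> \<F>. e \<subseteq> fv F})"
    using finite_faces by (simp add: sum.If_cases Int_def)
  also have "\<dots> \<le> (\<Sum>e\<in>E. 2)"
    by (rule sum_mono) (rule edge_faces_le_two(2))
  finally show ?thesis by simp
qed

section \<open>Lifting the graph and Euler's inequality on the surface\<close>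

lemma lifted_vertices:
  "finite {y \<in> S2. q y \<in> pt ` V}" "card {y \<in> S2. q y \<in> pt ` V} = d * card V"
proof -
  have eq: "{y \<in> S2. q y \<in> pt ` V} = (\<Union>v\<in>V. {y \<in> S2. q y = pt v})" by auto
  have fin: "finite {y \<in> S2. q y = pt v}" if "v \<in> V" for v
    using finite_fibre[of "pt v"] pt_X that by auto
  have "card (\<Union>v\<in>V. {y \<in> S2. q y = pt v}) = (\<Sum>v\<in>V. card {y \<in> S2. q y = pt v})"
  proof (rule card_UN_disjoint)
    show "\<forall>v\<in>V. \<forall>w\<in>V. v \<noteq> w \<longrightarrow> {y \<in> S2. q y = pt v} \<inter> {y \<in> S2. q y = pt w} = {}"
      using inj_pt by (auto simp: inj_on_def)
  qed (use finite_V fin in auto)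
  also have "\<dots> = (\<Sum>v\<in>V. d)"
    by (rule sum.cong[OF refl]) (rule fibre, use pt_X in auto)
  finally show "card {y \<in> S2. q y \<in> pt ` V} = d * card V" unfolding eq by simp
  show "finite {y \<in> S2. q y \<in> pt ` V}" unfolding eq using finite_V fin by blast
qed

lemma lifted_arc_system:
  obtains \<C> where "arc_system {y \<in> S2. q y \<in> pt ` V} \<C>" "card \<C> = d * card E"
    "{y \<in> S2. q y \<in> pt ` V} \<union> \<Union>\<C> = {y \<in> S2. q y \<in> graph_points}"
proof -
  let ?P = "{y \<in> S2. q y \<in> pt ` V}"
  have "\<forall>e\<in>E. \<exists>g. embedding_map (top_of_set {0..1::real}) X g \<and> {g 0, g 1} = pt ` e \<and> g ` {0..1} = curve e"
    using emb by (simp add: embedded_graph_def)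
  then obtain g where g: "\<And>e. e \<in> E \<Longrightarrow> embedding_map (top_of_set {0..1::real}) X (g e)"
      "\<And>e. e \<in> E \<Longrightarrow> {g e 0, g e 1} = pt ` e" "\<And>e. e \<in> E \<Longrightarrow> g e ` {0..1} = curve e"
    by metis
  have gc: "continuous_map (top_of_set {0..1}) X (g e)" and gi: "inj_on (g e) {0..1}" if "e \<in> E" for e
    by (rule embedding_mapD[OF g(1)[OF that]], assumption)+
  have "\<forall>e\<in>E. \<exists>L. lifts q d {0..1} (g e) L"
    using lift_line[OF _ gc] by simp
  then obtain L where L: "\<And>e. e \<in> E \<Longrightarrow> lifts q d {0..1} (g e) (L e)"
    by metis
  have Lc: "continuous_on {0..1} k" and LS: "k t \<in> S2" and Lq: "q (k t) = g e t"
    if "e \<in> E" "k \<in> L e" "t \<in> {0..1}" for e k t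
    using L[OF that(1)] that(2,3) unfolding lifts_def by blast+
  \<comment> \<open>The parameter is determined below, where the edge is injective, and then the
    lift, because lifts differ at every point. This gives injectivity of each lift, disjointness of
    the lifts of one edge, and the count.\<close>
  have Leq: "k = k' \<and> s = t" if "e \<in> E" "k \<in> L e" "k' \<in> L e" "s \<in> {0..1}" "t \<in> {0..1}" "k s = k' t" for e k k' s t
  proof -
    have "g e s = g e t" using Lq[of e k s] Lq[of e k' t] that by simp
    then have st: "s = t" using gi[OF that(1)] that(4,5) by (simp add: inj_on_def)
    have "inj_on (\<lambda>k. k t) (L e)" using L[OF that(1)] that(5) by (simp add: lifts_def)
    then show ?thesis using st that(2,3,6) by (simp add: inj_on_def)
  qed
  define im where "im = (\<lambda>p :: 'v set \<times> (real \<Rightarrow> real^3). snd p ` {0..1})"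
  define \<C> where "\<C> = im ` Sigma E L"
  have qim: "q ` k ` {0..1} = curve e" if "e \<in> E" "k \<in> L e" for e k
    unfolding g(3)[OF that(1), symmetric] image_image
    by (rule image_cong[OF refl]) (rule Lq[OF that])
  have curve_inj: "e = e'" if "e \<in> E" "e' \<in> E" "curve e = curve e'" for e e'
  proof -
    have "v \<in> e \<longleftrightarrow> v \<in> e'" if "v \<in> V" for v
      using pt_in_curve[OF \<open>e \<in> E\<close> that] pt_in_curve[OF \<open>e' \<in> E\<close> that] \<open>curve e = curve e'\<close> by simp
    then show ?thesis using E2[OF that(1)] E2[OF that(2)] by blast
  qed
  \<comment> \<open>Projection by q recovers the curve and with it the edge; one common point then
    recovers the lift.\<close>
  have "inj_on im (Sigma E L)"
  proof (rule inj_onI)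
    fix p p' assume p: "p \<in> Sigma E L" "p' \<in> Sigma E L" "im p = im p'"
    obtain e k e' k' where ek: "p = (e, k)" "p' = (e', k')" by (metis surj_pair)
    then have mem: "e \<in> E" "k \<in> L e" "e' \<in> E" "k' \<in> L e'" and im: "k ` {0..1} = k' ` {0..1}"
      using p by (auto simp: im_def)
    have "e = e'" using curve_inj[OF mem(1,3)] qim[OF mem(1,2)] qim[OF mem(3,4)] im by simp
    moreover have "k 0 \<in> k' ` {0..1}" unfolding im[symmetric] by simp
    then obtain t where t: "t \<in> {0..1}" "k 0 = k' t" by blast
    have "k' \<in> L e" using mem(4) \<open>e = e'\<close> by simp
    from Leq[OF mem(1,2) this _ t(1,2)] have "k = k'" by simp
    ultimately show "p = p'" using ek by simp
  qed
  then have "card \<C> = card (Sigma E L)" unfolding \<C>_def by (rule card_image)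
  also have "\<dots> = (\<Sum>e\<in>E. card (L e))"
  proof (rule card_SigmaI[OF finite_E], intro ballI)
    fix e assume "e \<in> E"
    then have "card (L e) = d" using L by (simp add: lifts_def)
    then show "finite (L e)" using d_pos card_ge_0_finite by metis
  qed
  also have "\<dots> = (\<Sum>e\<in>E. d)"
    by (rule sum.cong[OF refl]) (use L in \<open>simp add: lifts_def\<close>)
  finally have card: "card \<C> = d * card E" by simp
  have "finite (L e)" if "e \<in> E" for e
    using L[OF that] d_pos card_ge_0_finite[of "L e"] by (simp add: lifts_def)
  then have finC: "finite \<C>" unfolding \<C>_def using finite_E by (intro finite_imageI finite_SigmaI)
  have Celim: "\<exists>e k. e \<in> E \<and> k \<in> L e \<and> c = k ` {0..1}" if "c \<in> \<C>" for c
    using that unfolding \<C>_def im_def by fastforce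
  have arc: "c \<subseteq> S2 \<and> (\<exists>g. arc g \<and> path_image g = c \<and> c \<inter> ?P = {pathstart g, pathfinish g})" if "c \<in> \<C>" for c
  proof -
    obtain e k where ek: "e \<in> E" "k \<in> L e" "c = k ` {0..1}" using Celim[OF \<open>c \<in> \<C>\<close>] by blast
    have sub: "c \<subseteq> S2" unfolding ek(3) using LS[OF ek(1,2)] by blast
    have "inj_on k {0..1}"
      by (rule inj_onI) (use Leq[OF ek(1,2,2)] in blast)
    moreover have "continuous_on {0..1} k" using Lc[OF ek(1,2), of 0] by simp
    ultimately have arc: "arc k" by (simp add: arc_def path_def)
    have "k t \<in> ?P \<longleftrightarrow> t = 0 \<or> t = 1" if t: "t \<in> {0..1}" for t
    proof -
      have "k t \<in> ?P \<longleftrightarrow> g e t \<in> pt ` V" using Lq[OF ek(1,2) t] LS[OF ek(1,2) t] by simp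
      also have "\<dots> \<longleftrightarrow> g e t \<in> pt ` e"
        using curve_pt[OF ek(1)] g(3)[OF ek(1)] t by blast
      also have "\<dots> \<longleftrightarrow> g e t = g e 0 \<or> g e t = g e 1"
        unfolding g(2)[OF ek(1), symmetric] by simp
      also have "\<dots> \<longleftrightarrow> t = 0 \<or> t = 1"
        using inj_on_eq_iff[OF gi[OF ek(1)], of t 0] inj_on_eq_iff[OF gi[OF ek(1)], of t 1] t by simp
      finally show ?thesis .
    qed
    then have "{t \<in> {0..1}. k t \<in> ?P} = {t \<in> {0..1}. t = 0 \<or> t = 1}" by blast
    also have "\<dots> = {0, 1}" by auto
    finally have "k ` {t \<in> {0..1}. k t \<in> ?P} = k ` {0, 1}" by (rule arg_cong)
    moreover have "c \<inter> ?P = k ` {t \<in> {0..1}. k t \<in> ?P}" unfolding ek(3) by blast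
    ultimately have "c \<inter> ?P = k ` {0, 1}" by (simp only:)
    then have "c \<inter> ?P = {pathstart k, pathfinish k}" by (simp add: pathstart_def pathfinish_def)
    moreover have "path_image k = c" using ek(3) by (simp add: path_image_def)
    ultimately show ?thesis using sub arc by blast
  qed
  have disj: "c \<inter> c' \<subseteq> ?P" if c: "c \<in> \<C>" "c' \<in> \<C>" "c \<noteq> c'" for c c'
  proof
    fix y assume y: "y \<in> c \<inter> c'"
    obtain e k where ek: "e \<in> E" "k \<in> L e" "c = k ` {0..1}" using Celim[OF c(1)] by blast
    obtain e' k' where ek': "e' \<in> E" "k' \<in> L e'" "c' = k' ` {0..1}" using Celim[OF c(2)] by blast
    obtain s t where st: "s \<in> {0..1}" "t \<in> {0..1}" "y = k s" "y = k' t" using y ek(3) ek'(3) by blast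
    have "e \<noteq> e'"
    proof
      assume "e = e'"
      then have "k = k'" using Leq[OF ek(1,2) _ st(1,2)] ek'(2) st(3,4) by simp
      then show False using c(3) ek(3) ek'(3) by simp
    qed
    moreover have "q y \<in> curve e" "q y \<in> curve e'"
      using qim[OF ek(1,2)] qim[OF ek'(1,2)] st by blast+
    ultimately have "q y \<in> pt ` V" using curve_curve_pt[OF ek(1) ek'(1)] by blast
    then show "y \<in> ?P" using LS[OF ek(1,2) st(1)] st(3) by simp
  qed
  have sys: "arc_system ?P \<C>"
    unfolding arc_system_def using lifted_vertices(1) finC arc disj by auto
  have "\<Union>\<C> = {y \<in> S2. q y \<in> \<Union> (curve ` E)}"
  proof (intro equalityI subsetI)
    fix y assume "y \<in> \<Union>\<C>"
    then obtain c where c: "c \<in> \<C>" "y \<in> c" by blast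
    obtain e k where ek: "e \<in> E" "k \<in> L e" "c = k ` {0..1}" using Celim[OF c(1)] by blast
    have "q y \<in> curve e" using qim[OF ek(1,2)] c(2) ek(3) by blast
    moreover have "y \<in> S2" using arc[OF c(1)] c(2) by blast
    ultimately show "y \<in> {y \<in> S2. q y \<in> \<Union> (curve ` E)}" using ek(1) by blast
  next
    fix y assume "y \<in> {y \<in> S2. q y \<in> \<Union> (curve ` E)}"
    then obtain e where e: "y \<in> S2" "e \<in> E" "q y \<in> curve e" by blast
    then obtain t where t: "t \<in> {0..1}" "q y = g e t" using g(3)[OF e(2)] by blast
    then have "y \<in> (\<lambda>k. k t) ` L e" using lifts_fibre[OF L[OF e(2)] t(1)] e(1) by blast
    then obtain k where "k \<in> L e" "y = k t" by blast
    then show "y \<in> \<Union>\<C>" using e(2) t(1) unfolding \<C>_def im_def by force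
  qed
  then have "?P \<union> \<Union>\<C> = {y \<in> S2. q y \<in> graph_points}" by blast
  then show thesis using that[OF sys card] by blast
qed

text \<open>The sphere inequality for the lifted graph. Each region meets one of the d|F| lifted
  open discs, and a lifted disc, being connected and off the graph, meets only one region; so there
  are at most d|F| regions.\<close>

lemma Euler_inequality:
  assumes "V \<noteq> {}"
  shows "d * card E + 2 \<le> d * card \<F> + d * card V"
proof -
  let ?P = "{y \<in> S2. q y \<in> pt ` V}"
  obtain \<C> where \<C>: "arc_system ?P \<C>" "card \<C> = d * card E"
    "?P \<union> \<Union>\<C> = {y \<in> S2. q y \<in> graph_points}"
    using lifted_arc_system .
  obtain v where "v \<in> V" using assms by blast
  then have "pt v \<in> q ` S2" using surj_q pt_X by blast
  then obtain y where "y \<in> S2" "pt v = q y" by blast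
  then have "y \<in> ?P" using \<open>v \<in> V\<close> by (metis (mono_tags, lifting) imageI mem_Collect_eq)
  then have "?P \<noteq> {}" by blast
  then obtain \<Q> where \<Q>: "finite \<Q>" "\<And>U. U \<in> \<Q> \<Longrightarrow> openin (top_of_set S2) U \<and> U \<noteq> {}" "disjoint \<Q>"
    "\<Union>\<Q> = S2 - (?P \<union> \<Union>\<C>)" "card \<C> + 2 \<le> card \<Q> + card ?P"
    using sphere_Euler[OF \<C>(1)] by blast
  have UQ: "\<Union>\<Q> = {y \<in> S2. q y \<in> \<Union> \<F>}"
  proof -
    have "y \<in> S2 \<Longrightarrow> q y \<in> topspace X" for y using surj_q by blast
    then show ?thesis unfolding \<Q>(4) \<C>(3) Union_faces by blast
  qed
  have "\<forall>F\<in>\<F>. \<exists>h. embedding_map (top_of_set (cball (0 :: real^2) 1)) X h \<and> h ` ball 0 1 = F"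
    using face_disc by metis
  then obtain h where h: "\<And>F. F \<in> \<F> \<Longrightarrow> embedding_map (top_of_set (cball (0 :: real^2) 1)) X (h F)"
      "\<And>F. F \<in> \<F> \<Longrightarrow> h F ` ball 0 1 = F"
    by metis
  have hc: "continuous_map (top_of_set (ball 0 1)) X (h F)" if "F \<in> \<F>" for F
    by (rule embedding_mapD[OF h(1)[OF that]], rule continuous_map_from_subtopology_mono[OF _ ball_subset_cball])
  have "\<forall>F\<in>\<F>. \<exists>L. lifts q d (ball 0 1) (h F) L"
    using lift_plane[OF convex_ball hc] by simp
  then obtain L where L: "\<And>F. F \<in> \<F> \<Longrightarrow> lifts q d (ball 0 1) (h F) (L F)"
    by metis
  have sheet: "\<exists>p\<in>Sigma \<F> L. snd p ` ball 0 1 \<inter> U \<noteq> {}" if U: "U \<in> \<Q>" for U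
  proof -
    obtain y where y: "y \<in> U" using \<Q>(2)[OF U] by blast
    then have "y \<in> \<Union>\<Q>" using U by blast
    then obtain F where F: "F \<in> \<F>" "q y \<in> F" and yS: "y \<in> S2" unfolding UQ by blast
    then obtain z where z: "z \<in> ball 0 1" "q y = h F z" using h(2)[OF F(1)] by blast
    then have "y \<in> (\<lambda>k. k z) ` L F" using lifts_fibre[OF L[OF F(1)] z(1)] yS by blast
    then obtain k where k: "k \<in> L F" "y = k z" by blast
    then have "k ` ball 0 1 \<inter> U \<noteq> {}" using z(1) y by blast
    then show ?thesis using F(1) k(1) by (intro bexI[of _ "(F, k)"]) simp_all
  qed
  then obtain p where p: "\<And>U. U \<in> \<Q> \<Longrightarrow> p U \<in> Sigma \<F> L \<and> snd (p U) ` ball 0 1 \<inter> U \<noteq> {}"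
    by metis
  have "inj_on p \<Q>"
  proof (rule inj_onI, rule ccontr)
    fix U U' assume U: "U \<in> \<Q>" "U' \<in> \<Q>" "p U = p U'" "U \<noteq> U'"
    obtain F k where Fk: "p U = (F, k)" by (metis surj_pair)
    then have F: "F \<in> \<F>" "k \<in> L F" using p[OF U(1)] by auto
    let ?K = "k ` ball 0 1"
    have k: "continuous_on (ball 0 1) k" "?K \<subseteq> S2" "\<And>z. z \<in> ball 0 1 \<Longrightarrow> q (k z) = h F z"
      using L[OF F(1)] F(2) unfolding lifts_def by blast+
    have conn: "connected ?K" using k(1) by (intro connected_continuous_image) auto
    have "q (k z) \<in> F" if "z \<in> ball 0 1" for z
      using k(3)[OF that] h(2)[OF F(1)] that by blast
    then have KQ: "?K \<subseteq> \<Union>\<Q>" unfolding UQ using k(2) F(1) by blast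
    \<comment> \<open>Uniting all regions other than U leaves two open sets that would disconnect
      the sheet.\<close>
    have "openin (top_of_set S2) (\<Union> (\<Q> - {U}))" using \<Q>(2) by (intro openin_Union) blast
    then obtain T' where T': "open T'" "\<Union> (\<Q> - {U}) = S2 \<inter> T'" by (auto simp: openin_open)
    obtain T where T: "open T" "U = S2 \<inter> T" using \<Q>(2)[OF U(1)] by (auto simp: openin_open)
    have dis: "U \<inter> \<Union> (\<Q> - {U}) = {}"
      using \<Q>(3) U(1) by (auto simp: disjoint_def)
    have "T \<inter> ?K = {} \<or> T' \<inter> ?K = {}"
    proof (rule connectedD[OF conn T(1) T'(1)])
      show "T \<inter> T' \<inter> ?K = {}" using dis k(2) unfolding T'(2) unfolding T(2) by blast
      have "\<Union>\<Q> = U \<union> \<Union> (\<Q> - {U})" using U(1) by blast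
      also have "\<dots> \<subseteq> T \<union> T'" unfolding T'(2) using T(2) by auto
      finally show "?K \<subseteq> T \<union> T'" using KQ by (rule order_trans[rotated])
    qed
    moreover have "?K \<inter> U \<noteq> {}" using p[OF U(1)] Fk by simp
    then have "T \<inter> ?K \<noteq> {}" using T(2) by auto
    moreover have "?K \<inter> U' \<noteq> {}" using p[OF U(2)] Fk U(3) by simp
    moreover have "U' \<subseteq> S2 \<inter> T'" unfolding T'(2)[symmetric] using U by blast
    ultimately show False by auto
  qed
  moreover have "p ` \<Q> \<subseteq> Sigma \<F> L" using p by blast
  moreover have cardL: "finite (L F) \<and> card (L F) = d" if "F \<in> \<F>" for F
    using L[OF that] d_pos card_ge_0_finite[of "L F"] by (simp add: lifts_def)
  then have "finite (Sigma \<F> L)" using finite_faces by (intro finite_SigmaI) auto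
  ultimately have "card \<Q> \<le> card (Sigma \<F> L)" by (intro card_inj_on_le)
  also have "\<dots> = d * card \<F>" using finite_faces cardL by simp
  finally show ?thesis using \<Q>(5) \<C>(2) lifted_vertices(2) by simp
qed

end

section \<open>Counting colors\<close>

text \<open>A connected graph on K has at least |K| - 1 edges: a set grown by one element at a time
  gains a new pair at each step. It is applied to colors.\<close>

lemma card_le_connecting_pairs:
  assumes "finite K" "K \<noteq> {}" "finite R"
    and conn: "\<And>S. S \<subseteq> K \<Longrightarrow> S \<noteq> {} \<Longrightarrow> S \<noteq> K \<Longrightarrow> \<exists>a\<in>S. \<exists>b\<in>K - S. {a, b} \<in> R"
  shows "card K \<le> card R + 1"
proof -
  have grow: "\<exists>S\<subseteq>K. card S = Suc m \<and> m \<le> card {r \<in> R. r \<subseteq> S}" if "Suc m \<le> card K" for m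
    using that
  proof (induction m)
    case 0
    obtain a where "a \<in> K" using assms(2) by blast
    then show ?case by (intro exI[of _ "{a}"]) auto
  next
    case (Suc m)
    then obtain S where S: "S \<subseteq> K" "card S = Suc m" "m \<le> card {r \<in> R. r \<subseteq> S}" by auto
    have "S \<noteq> {}" "S \<noteq> K" using S Suc.prems by auto
    then obtain a b where ab: "a \<in> S" "b \<in> K - S" "{a, b} \<in> R" using conn S(1) by blast
    have "insert {a, b} {r \<in> R. r \<subseteq> S} \<subseteq> {r \<in> R. r \<subseteq> insert b S}" using ab by auto
    then have "card (insert {a, b} {r \<in> R. r \<subseteq> S}) \<le> card {r \<in> R. r \<subseteq> insert b S}"
      using assms(3) by (intro card_mono) auto
    moreover have "card (insert {a, b} {r \<in> R. r \<subseteq> S}) = Suc (card {r \<in> R. r \<subseteq> S})"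
      using ab assms(3) by (intro card_insert_disjoint) auto
    moreover have "card (insert b S) = Suc (Suc m)"
      using ab S finite_subset[OF S(1) assms(1)] by simp
    ultimately show ?case using S ab by (intro exI[of _ "insert b S"]) auto
  qed
  have "Suc (card K - 1) \<le> card K" using assms(1,2) by (simp add: card_gt_0_iff)
  from grow[OF this] obtain S where "card K - 1 \<le> card {r \<in> R. r \<subseteq> S}" by blast
  also have "\<dots> \<le> card R" using assms(3) by (intro card_mono) auto
  finally show ?thesis by simp
qed

text \<open>The combinatorial core, with faces reduced to abstract triples. Injectivity of
  \<open>fv\<close> is what gives two faces at an edge different apexes.\<close>

lemma non_rainbow_color_bound:
  fixes fv :: "'f \<Rightarrow> 'v set" and f :: "'v \<Rightarrow> 'c"
  assumes fin: "finite \<F>" "finite V" "V \<noteq> {}"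
    and E2: "\<And>e. e \<in> E \<Longrightarrow> e \<subseteq> V \<and> card e = 2"
    and fv3: "\<And>F. F \<in> \<F> \<Longrightarrow> card (fv F) = 3"
    and fvE: "\<And>F e. F \<in> \<F> \<Longrightarrow> e \<subseteq> fv F \<Longrightarrow> card e = 2 \<Longrightarrow> e \<in> E"
    and two: "\<And>e. e \<in> E \<Longrightarrow> \<exists>F1\<in>\<F>. \<exists>F2\<in>\<F>. F1 \<noteq> F2 \<and> e \<subseteq> fv F1 \<and> e \<subseteq> fv F2"
    and inj: "inj_on fv \<F>"
    and conn: "\<And>U. U \<subseteq> V \<Longrightarrow> U \<noteq> {} \<Longrightarrow> U \<noteq> V \<Longrightarrow> \<exists>u\<in>U. \<exists>w\<in>V - U. {u, w} \<in> E"
    and nr: "\<And>F. F \<in> \<F> \<Longrightarrow> \<not> inj_on f (fv F)"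
  shows "3 * card (f ` V) \<le> card \<F> + 3"
proof -
  have finfv: "finite (fv F)" if "F \<in> \<F>" for F
    using fv3[OF that] by (intro card_ge_0_finite) simp
  have color: "f ` fv F = {f u, f v}" if F: "F \<in> \<F>" and uv: "u \<in> fv F" "v \<in> fv F" "f u \<noteq> f v" for F u v
  proof -
    have "card (f ` fv F) \<noteq> card (fv F)"
      using nr[OF F] finfv[OF F] eq_card_imp_inj_on by blast
    then have "card (f ` fv F) \<le> card {f u, f v}"
      using card_image_le[OF finfv[OF F], of f] fv3[OF F] uv(3) by simp
    moreover have "{f u, f v} \<subseteq> f ` fv F" using uv by blast
    ultimately show ?thesis using card_seteq[of "f ` fv F" "{f u, f v}"] finfv[OF F] by simp
  qed
  \<comment> \<open>The edges of the color graph; the cardinality condition drops the monochromatic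
    edges.\<close>
  define R where "R = {r \<in> (`) f ` E. card r = 2}"
  have "finite E" using E2 fin(2) by (intro finite_subset[of E "Pow V"]) auto
  then have finR: "finite R" by (simp add: R_def)
  have three: "3 \<le> card {F \<in> \<F>. f ` fv F = r}" if r: "r \<in> R" for r
  proof -
    obtain e where e: "e \<in> E" "r = f ` e" "card r = 2" using r by (auto simp: R_def)
    obtain u v where uv: "e = {u, v}" using E2[OF e(1)] by (auto simp: card_2_iff)
    then have fuv: "f u \<noteq> f v" and ruv: "r = {f u, f v}" using e by auto
    obtain F1 F2 where F: "F1 \<in> \<F>" "F2 \<in> \<F>" "F1 \<noteq> F2" "e \<subseteq> fv F1" "e \<subseteq> fv F2"
      using two[OF e(1)] by blast
    have "\<not> fv F1 \<subseteq> fv F2"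
    proof
      assume "fv F1 \<subseteq> fv F2"
      then have "fv F1 = fv F2"
        using card_subset_eq[OF finfv[OF F(2)]] fv3[OF F(1)] fv3[OF F(2)] by simp
      then show False using inj F(1-3) by (simp add: inj_on_def)
    qed
    then obtain w where w: "w \<in> fv F1" "w \<notin> fv F2" by blast
    have c1: "f ` fv F1 = r" using color[OF F(1) _ _ fuv] F(4) uv ruv by simp
    have c2: "f ` fv F2 = r" using color[OF F(2) _ _ fuv] F(5) uv ruv by simp
    have "f w \<in> {f u, f v}" using c1 w(1) ruv by blast
    \<comment> \<open>The apex w shares its color with one end of e; a is the other end, so the edge
      from a to w carries the same two colors as e.\<close>
    have "\<exists>a\<in>{u, v}. f a \<noteq> f w" using fuv by auto
    then obtain a where a: "a \<in> {u, v}" "f a \<noteq> f w" by blast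
    have "f a \<in> {f u, f v}" using a(1) by auto
    then have raw: "r = {f a, f w}" using \<open>f w \<in> {f u, f v}\<close> a(2) ruv by auto
    have "a \<in> fv F1" using a(1) F(4) uv by auto
    moreover have "card {a, w} = 2" using a(2) by (cases "a = w") auto
    ultimately have "{a, w} \<in> E" using fvE[OF F(1), of "{a, w}"] w(1) by simp
    \<comment> \<open>The other face at this edge; it contains w and is therefore not F2.\<close>
    then obtain F3 where F3: "F3 \<in> \<F>" "F3 \<noteq> F1" "{a, w} \<subseteq> fv F3" using two by metis
    have "F3 \<noteq> F2" using F3(3) w(2) by auto
    have c3: "f ` fv F3 = r" using color[OF F3(1) _ _ a(2)] F3(3) raw by simp
    have "{F1, F2, F3} \<subseteq> {F \<in> \<F>. f ` fv F = r}" using F F3 c1 c2 c3 by simp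
    then have "card {F1, F2, F3} \<le> card {F \<in> \<F>. f ` fv F = r}" using fin(1) by (intro card_mono) auto
    moreover have "card {F1, F2, F3} = 3" using F(3) F3(2) \<open>F3 \<noteq> F2\<close> by auto
    ultimately show ?thesis by simp
  qed
  have "3 * card R = (\<Sum>r\<in>R. 3)" by simp
  also have "\<dots> \<le> (\<Sum>r\<in>R. card {F \<in> \<F>. f ` fv F = r})" by (rule sum_mono) (rule three)
  also have "\<dots> = card (\<Union>r\<in>R. {F \<in> \<F>. f ` fv F = r})"
    using finR fin(1) by (intro card_UN_disjoint[symmetric]) auto
  also have "\<dots> \<le> card \<F>" using fin(1) by (intro card_mono) auto
  finally have "3 * card R \<le> card \<F>" .
  moreover have "card (f ` V) \<le> card R + 1"
  proof (rule card_le_connecting_pairs[OF _ _ finR])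
    \<comment> \<open>A set of colors is pulled back to vertices, where connectedness is
      known.\<close>
    fix S assume S: "S \<subseteq> f ` V" "S \<noteq> {}" "S \<noteq> f ` V"
    define U where "U = {v \<in> V. f v \<in> S}"
    have "U \<subseteq> V" "U \<noteq> {}" "U \<noteq> V" using S by (auto simp: U_def)
    then obtain u w where uw: "u \<in> U" "w \<in> V - U" "{u, w} \<in> E" using conn by blast
    then have S: "f u \<in> S" "f w \<in> f ` V - S" by (auto simp: U_def)
    then have "card (f ` {u, w}) = 2" by (auto simp: card_insert_if)
    then have "f ` {u, w} \<in> R" unfolding R_def using uw(3) by blast
    then show "\<exists>a\<in>S. \<exists>b\<in>f ` V - S. {a, b} \<in> R" using S by auto
  qed (use fin in auto)
  ultimately show ?thesis by simp
qed

context triangulation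
begin

lemma color_bound:
  assumes V4: "4 \<le> card V" and nr: "non_rainbow X V E pt curve f"
  shows "d * (3 * card (f ` V)) + 4 \<le> d * (2 * card V + 3)"
proof -
  have "V \<noteq> {}" using V4 by auto
  have "3 * card (f ` V) \<le> card \<F> + 3"
  proof (rule non_rainbow_color_bound[where fv = fv and E = E])
    show "\<exists>F1\<in>\<F>. \<exists>F2\<in>\<F>. F1 \<noteq> F2 \<and> e \<subseteq> fv F1 \<and> e \<subseteq> fv F2" if "e \<in> E" for e
      by (rule edge_two_faces[OF that]) blast
    show "\<not> inj_on f (fv F)" if "F \<in> \<F>" for F
      using nr that by (simp add: non_rainbow_def rainbow_face_def)
  qed (use finite_faces finite_V \<open>V \<noteq> {}\<close> E2 card_fv fv_edge inj_on_fv[OF V4] edge_leaves_vertex_set in auto)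
  then have "d * (3 * card (f ` V)) \<le> d * (card \<F> + 3)" by (rule mult_le_mono2)
  moreover have "d * (3 * card \<F>) \<le> d * (2 * card E)"
    using three_faces_le_two_edges by (rule mult_le_mono2)
  \<comment> \<open>3d|F| <= 2d|E| <= 2d|F| + 2d|V| - 4, so d|F| + 4 <= 2d|V|. The factor d is
    multiplied through beforehand to make the products atoms of a linear problem.\<close>
  ultimately show ?thesis
    using Euler_inequality[OF \<open>V \<noteq> {}\<close>] unfolding add_mult_distrib2 mult.left_commute[of d] by linarith
qed

end

section \<open>The sphere and the projective plane as quotients of the sphere\<close>

lemma sphere_surface_cover:
  assumes "sphere_surface X"
  shows "\<exists>q. sphere_cover X q 1"
proof -
  obtain r q where rq: "homeomorphic_maps X (top_of_set S2) r q"
    using assms by (auto simp: sphere_surface_def homeomorphic_space_def)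
  then have cr: "continuous_map X (top_of_set S2) r" and cq: "continuous_map (top_of_set S2) X q"
    and qr: "\<And>x. x \<in> topspace X \<Longrightarrow> q (r x) = x" and rq': "\<And>y. y \<in> S2 \<Longrightarrow> r (q y) = y"
    by (auto simp: homeomorphic_maps_def)
  have hq: "homeomorphic_map (top_of_set S2) X q"
    using rq homeomorphic_maps_sym homeomorphic_maps_map by blast
  have rS: "r x \<in> S2" if "x \<in> topspace X" for x
    using continuous_map_funspace[OF cr] that by auto
  have lift: "\<exists>L. lifts q 1 D h L" if "continuous_map (top_of_set D) X h"
    for D :: "'b::topological_space set" and h
  proof -
    have "continuous_map (top_of_set D) (top_of_set S2) (r \<circ> h)"
      using that cr by (rule continuous_map_compose)
    then have "continuous_on D (r \<circ> h)" "(r \<circ> h) ` D \<subseteq> S2" by auto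
    moreover have "q ((r \<circ> h) z) = h z" if "z \<in> D" for z
      using qr continuous_map_funspace[OF \<open>continuous_map (top_of_set D) X h\<close>] that by auto
    ultimately have "lifts q 1 D h {r \<circ> h}" unfolding lifts_def by simp
    then show ?thesis by blast
  qed
  have "sphere_cover X q 1"
  proof
    show "continuous_map (top_of_set S2) X q" by (rule cq)
    show "open_map (top_of_set S2) X q" using hq homeomorphic_imp_open_map by blast
    show "q ` S2 = topspace X" using homeomorphic_imp_surjective_map[OF hq] by simp
    show "Hausdorff_space X"
      using homeomorphic_Hausdorff_space[of X "top_of_set S2"] rq
      by (auto simp: homeomorphic_space_def Hausdorff_space_subtopology Hausdorff_space_euclidean)
    show "card {y \<in> S2. q y = x} = 1" if "x \<in> topspace X" for x
    proof -
      have "{y \<in> S2. q y = x} = {r x}" using rq' qr[OF that] rS[OF that] by auto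
      then show ?thesis by simp
    qed
    show "\<exists>U. openin (top_of_set S2) U \<and> y \<in> U \<and> inj_on q U" if "y \<in> S2" for y
      using that inj_on_inverseI[of S2 r q, OF rq'] by (intro exI[of _ S2]) auto
  qed (use lift in auto)
  then show ?thesis by blast
qed

text \<open>The matrix of rank one formed from y and its transpose; for a unit vector it is the
  projection onto the line of y. It realizes the projective plane inside a Euclidean space, where
  the theory of covering spaces applies.\<close>

definition outer :: "real^3 \<Rightarrow> real^3^3" where
  "outer y = (\<chi> i. y $ i *\<^sub>R y)"

lemma outer_mult: "outer y *v z = (y \<bullet> z) *\<^sub>R y"
  by (simp add: vec_eq_iff outer_def matrix_vector_mult_def inner_vec_def sum_distrib_left mult_ac)

lemma outer_minus: "outer (- y) = outer y"
  by (simp add: vec_eq_iff outer_def)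

text \<open>Applied to x, the matrix of x fixes x while that of y yields a multiple of y; equal
  norms leave only the factors 1 and -1.\<close>

lemma outer_eq_iff:
  assumes "x \<in> S2" "y \<in> S2"
  shows "outer x = outer y \<longleftrightarrow> y = x \<or> y = - x"
proof
  assume eq: "outer x = outer y"
  have "x \<bullet> x = 1" using assms(1) by (simp add: dot_square_norm)
  then have "x = (y \<bullet> x) *\<^sub>R y" using outer_mult[of x x] outer_mult[of y x] eq by simp
  then have *: "x = c *\<^sub>R y" if "c = y \<bullet> x" for c using that by simp
  obtain c where c: "c = y \<bullet> x" by simp
  have xy: "x = c *\<^sub>R y" by (rule *[OF c])
  then have "norm x = \<bar>c\<bar> * norm y" by simp
  then have "\<bar>c\<bar> = 1" using assms by simp
  then have "c = 1 \<or> c = -1" by linarith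
  then show "y = x \<or> y = - x" using xy by auto
next
  show "y = x \<or> y = - x \<Longrightarrow> outer x = outer y" by (auto simp: outer_minus)
qed

lemma continuous_outer: "continuous_on S outer"
  unfolding outer_def by (intro continuous_intros continuous_on_vec_lambda)

lemma continuous_mult_vec: "continuous_on S (\<lambda>M :: real^3^3. M *v w)"
proof -
  have "linear (\<lambda>M :: real^3^3. M *v w)"
    by (rule linearI) (simp_all add: matrix_vector_mult_add_rdistrib scaleR_matrix_vector_assoc)
  then show ?thesis by (simp add: linear_continuous_on linear_conv_bounded_linear)
qed

text \<open>Over the lines not orthogonal to w, the set T, lie the two open hemispheres around w and
  -w, and each of them maps homeomorphically onto T.\<close>

lemma covering_space_outer: "covering_space S2 outer (outer ` S2)"
  unfolding covering_space_def
proof (intro conjI ballI)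
  show "continuous_on S2 outer" by (rule continuous_outer)
  fix M0 assume "M0 \<in> outer ` S2"
  then obtain w where w: "w \<in> S2" "M0 = outer w" by blast
  define T where "T = outer ` S2 \<inter> {M. 0 < w \<bullet> (M *v w)}"
  define H where "H = (\<lambda>s :: real. S2 \<inter> {y. 0 < s * (y \<bullet> w)})"
  have q: "w \<bullet> (outer y *v w) = (y \<bullet> w)\<^sup>2" for y
    by (simp add: outer_mult inner_commute power2_eq_square)
  have ww: "w \<bullet> w = 1" using w(1) by (simp add: dot_square_norm)
  have opT: "openin (top_of_set (outer ` S2)) T"
    unfolding T_def by (intro openin_open_Int open_Collect_less continuous_intros continuous_mult_vec)
  have opH: "openin (top_of_set S2) (H s)" for s
    unfolding H_def by (intro openin_open_Int open_Collect_less continuous_intros)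
  have imH: "outer ` H s = T" if s: "s = 1 \<or> s = -1" for s
  proof (intro equalityI subsetI)
    fix M assume "M \<in> outer ` H s"
    then obtain y where "y \<in> S2" "0 < s * (y \<bullet> w)" "M = outer y" by (auto simp: H_def)
    moreover from this(2) have "y \<bullet> w \<noteq> 0" by auto
    ultimately show "M \<in> T" by (simp add: T_def q)
  next
    fix M assume "M \<in> T"
    then obtain y where y: "y \<in> S2" "0 < (y \<bullet> w)\<^sup>2" "M = outer y" by (auto simp: T_def q)
    then have "y \<bullet> w < 0 \<or> 0 < y \<bullet> w" by auto
    then have "y \<in> H s \<or> - y \<in> H s" using s y(1) by (auto simp: H_def)
    then show "M \<in> outer ` H s" using y(3) outer_minus by (metis imageI)
  qed
  have homeo: "\<exists>r. homeomorphism (H s) T outer r" if s: "s = 1 \<or> s = -1" for s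
  proof -
    \<comment> \<open>For \<open>M = outer y\<close> the vector \<open>M *v w\<close> is y scaled by
      its inner product with w, and the radicand is the square of that inner product; the sign s
      selects the hemisphere.\<close>
    define r where "r = (\<lambda>M :: real^3^3. s *\<^sub>R (M *v w) /\<^sub>R sqrt (w \<bullet> (M *v w)))"
    have r: "r (outer y) = y" if "y \<in> H s" for y
    proof -
      have sy: "0 < s * (y \<bullet> w)" using that by (simp add: H_def)
      have "sqrt ((y \<bullet> w)\<^sup>2) = s * (y \<bullet> w)" using sy s by auto
      moreover have "r (outer y) = s *\<^sub>R ((y \<bullet> w) *\<^sub>R y) /\<^sub>R sqrt ((y \<bullet> w)\<^sup>2)"
        unfolding r_def q by (simp only: outer_mult)
      ultimately have "r (outer y) = (inverse (s * (y \<bullet> w)) * (s * (y \<bullet> w))) *\<^sub>R y"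
        by (simp only: scaleR_scaleR mult.assoc)
      then show ?thesis using sy by (simp only: left_inverse less_irrefl scaleR_one)
    qed
    have "continuous_on T r"
      unfolding r_def by (intro continuous_intros continuous_mult_vec) (auto simp: T_def)
    moreover have "r ` T = H s" unfolding imH[OF s, symmetric] using r by force
    moreover have "outer (r M) = M" if "M \<in> T" for M
      using that r unfolding imH[OF s, symmetric] by auto
    ultimately have "homeomorphism (H s) T outer r"
      unfolding homeomorphism_def using r imH[OF s] continuous_outer by auto
    then show ?thesis by blast
  qed
  show "\<exists>T. M0 \<in> T \<and> openin (top_of_set (outer ` S2)) T \<and>
          (\<exists>v. \<Union>v = S2 \<inter> outer -` T \<and> (\<forall>u\<in>v. openin (top_of_set S2) u) \<and> pairwise disjnt v \<and>
               (\<forall>u\<in>v. \<exists>q. homeomorphism u T outer q))"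
  proof (intro exI[of _ T] conjI exI[of _ "{H 1, H (-1)}"])
    show "M0 \<in> T" using w ww by (auto simp: T_def q)
    show "\<Union> {H 1, H (- 1)} = S2 \<inter> outer -` T" by (auto simp: H_def T_def q)
    show "pairwise disjnt {H 1, H (- 1)}" by (auto simp: pairwise_insert disjnt_def H_def)
  qed (use opT opH homeo in auto)
qed simp

text \<open>The map \<open>\<theta>\<close> transports h into the matrix model. A convex set is
  simply connected, so the composite lifts to some k, and the second sheet is the negative of
  k.\<close>

lemma antipodal_lifts:
  fixes D :: "'b::euclidean_space set"
  assumes qq: "\<And>x y. x \<in> S2 \<Longrightarrow> y \<in> S2 \<Longrightarrow> q x = q y \<longleftrightarrow> y = x \<or> y = - x"
    and surj: "q ` S2 = topspace X" and \<theta>: "continuous_map X euclidean \<theta>" "\<And>x. x \<in> S2 \<Longrightarrow> \<theta> (q x) = outer x"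
    and D: "convex D" and h: "continuous_map (top_of_set D) X h"
  shows "\<exists>L. lifts q 2 D h L"
proof (cases "D = {}")
  case True
  \<comment> \<open>On an empty domain any two distinct functions are the required two lifts; k and
    its negative could not be told apart by a point.\<close>
  have "(\<lambda>z :: 'b. 0 :: real^3) \<noteq> (\<lambda>z. axis 1 1)"
    by (simp add: fun_eq_iff axis_eq_0_iff)
  then have "lifts q 2 D h {\<lambda>z. 0, \<lambda>z. axis 1 1}" using True by (simp add: lifts_def)
  then show ?thesis by blast
next
  case False
  have hX: "h z \<in> q ` S2" if "z \<in> D" for z
    using continuous_map_funspace[OF h] that surj by auto
  have "continuous_map (top_of_set D) euclidean (\<theta> \<circ> h)" using h \<theta>(1) by (rule continuous_map_compose)
  then have "continuous_on D (\<theta> \<circ> h)" by simp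
  moreover have "(\<theta> \<circ> h) \<in> D \<rightarrow> outer ` S2"
  proof
    fix z assume "z \<in> D"
    then obtain y where "y \<in> S2" "h z = q y" using hX by blast
    then show "(\<theta> \<circ> h) z \<in> outer ` S2" using \<theta>(2) by simp
  qed
  ultimately obtain k where k: "continuous_on D k" "k \<in> D \<rightarrow> S2" "\<And>z. z \<in> D \<Longrightarrow> outer (k z) = (\<theta> \<circ> h) z"
    using covering_space_lift[OF covering_space_outer convex_imp_simply_connected[OF D]
        convex_imp_locally_path_connected[OF D]] by metis
  have kS: "k z \<in> S2" "- k z \<in> S2" if "z \<in> D" for z using k(2) that by auto
  have qk: "q (k z) = h z" if "z \<in> D" for z
  proof -
    obtain y where y: "y \<in> S2" "h z = q y" using hX \<open>z \<in> D\<close> by blast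
    then have "outer (k z) = outer y" using k(3)[OF that] \<theta>(2) by simp
    then show ?thesis using qq[OF kS(1)[OF that] y(1)] outer_eq_iff[OF kS(1)[OF that] y(1)] y(2) by simp
  qed
  have qmk: "q (- k z) = h z" if "z \<in> D" for z
    using qq[OF kS[OF that]] qk[OF that] by simp
  have neq: "- k z \<noteq> k z" if "z \<in> D" for z using minus_sphere_neq[OF kS(1)[OF that]] .
  let ?L = "{k, \<lambda>z. - k z}"
  obtain z0 where "z0 \<in> D" using False by blast
  then have "(\<lambda>z. - k z) \<noteq> k" using neq by metis
  then have "card ?L = 2" by auto
  moreover have "inj_on (\<lambda>g. g z) ?L" if "z \<in> D" for z using neq[OF that] by (auto simp: inj_on_def)
  moreover have "continuous_on D k \<and> k ` D \<subseteq> S2 \<and> (\<forall>z\<in>D. q (k z) = h z)"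
    using k(1) kS(1) qk by blast
  moreover have "continuous_on D (\<lambda>z. - k z) \<and> (\<lambda>z. - k z) ` D \<subseteq> S2 \<and> (\<forall>z\<in>D. q (- k z) = h z)"
    using continuous_on_minus[OF k(1)] kS(2) qmk by blast
  ultimately have "lifts q 2 D h ?L"
    unfolding lifts_def by simp
  then show ?thesis by blast
qed

lemma projective_plane_surface_cover:
  assumes "projective_plane_surface X"
  shows "\<exists>q. sphere_cover X q 2"
proof -
  obtain q where quo: "quotient_map (top_of_set S2) X q"
    and "\<forall>x\<in>S2. \<forall>y\<in>S2. q x = q y \<longleftrightarrow> y = x \<or> y = - x"
    using assms unfolding projective_plane_surface_def by blast
  then have qq: "q x = q y \<longleftrightarrow> y = x \<or> y = - x" if "x \<in> S2" "y \<in> S2" for x y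
    using that by blast
  have surj: "q ` S2 = topspace X" using quotient_imp_surjective_map[OF quo] by simp
  have cont: "continuous_map (top_of_set S2) X q" using quo by (rule quotient_imp_continuous_map)
  \<comment> \<open>\<open>outer\<close> is constant on the fibres of the quotient map and so
    factors through X. The factor is injective, which makes X Hausdorff.\<close>
  obtain \<theta> where \<theta>: "continuous_map X euclidean \<theta>" "\<And>x. x \<in> S2 \<Longrightarrow> \<theta> (q x) = outer x"
  proof (rule quotient_map_lift_exists[OF quo, of euclidean outer])
    show "continuous_map (top_of_set S2) euclidean outer" by (simp add: continuous_outer)
    show "outer x = outer y" if "x \<in> topspace (top_of_set S2)" "y \<in> topspace (top_of_set S2)" "q x = q y" for x y
      using qq[of x y] outer_eq_iff[of x y] that by simp
  qed auto
  have inj\<theta>: "inj_on \<theta> (topspace X)"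
  proof (rule inj_onI)
    fix a b assume ab: "a \<in> topspace X" "b \<in> topspace X" "\<theta> a = \<theta> b"
    then obtain x y where "x \<in> S2" "y \<in> S2" "a = q x" "b = q y" unfolding surj[symmetric] by blast
    then show "a = b" using ab(3) \<theta>(2) qq[of x y] outer_eq_iff[of x y] by simp
  qed
  have "sphere_cover X q 2"
  proof
    show "open_map (top_of_set S2) X q"
      unfolding open_map_def
    proof (intro allI impI)
      fix U assume U: "openin (top_of_set S2) U"
      then obtain T where T: "open T" "U = S2 \<inter> T" by (auto simp: openin_open)
      \<comment> \<open>The saturation of U is its union with the antipodal image, so the quotient
        topology makes the image of U open.\<close>
      have "{x \<in> S2. q x \<in> q ` U} = S2 \<inter> (T \<union> uminus ` T)"
      proof (intro equalityI subsetI)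
        fix x assume "x \<in> {x \<in> S2. q x \<in> q ` U}"
        then obtain y where "x \<in> S2" "y \<in> U" "q x = q y" by auto
        moreover have "y \<in> S2" using \<open>y \<in> U\<close> T(2) by simp
        ultimately show "x \<in> S2 \<inter> (T \<union> uminus ` T)" using qq[of y x] T(2) by auto
      next
        fix x assume x: "x \<in> S2 \<inter> (T \<union> uminus ` T)"
        then have "x \<in> U \<or> - x \<in> U" using T(2) by auto
        moreover have "q (- x) = q x" using qq[of x "- x"] x by simp
        ultimately show "x \<in> {x \<in> S2. q x \<in> q ` U}" using x by (metis (mono_tags, lifting) IntE imageI mem_Collect_eq)
      qed
      then have "openin (top_of_set S2) {x \<in> topspace (top_of_set S2). q x \<in> q ` U}"
        using T(1) open_negations[OF T(1)] by (simp add: openin_open_Int open_Un)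
      moreover have "q ` U \<subseteq> topspace X" using surj T(2) by blast
      ultimately show "openin X (q ` U)" using quo unfolding quotient_map_def by blast
    qed
    show "Hausdorff_space X"
      by (rule Hausdorff_space_injective_preimage[OF Hausdorff_space_euclidean \<theta>(1) inj\<theta>])
    show "card {y \<in> S2. q y = x} = 2" if x: "x \<in> topspace X" for x
    proof -
      obtain y where y: "y \<in> S2" "x = q y" using x unfolding surj[symmetric] by blast
      have "q z = x \<longleftrightarrow> z = y \<or> z = - y" if "z \<in> S2" for z
        unfolding y(2) using qq[OF y(1) that] by (simp only: eq_commute[of "q z"])
      moreover have "- y \<in> S2" using y(1) by simp
      ultimately have "{z \<in> S2. q z = x} = {y, - y}" using y(1) by blast
      then show ?thesis using minus_sphere_neq[OF y(1)] by (metis card_2_iff)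
    qed
    show "\<exists>U. openin (top_of_set S2) U \<and> y \<in> U \<and> inj_on q U" if y: "y \<in> S2" for y
    proof (intro exI conjI)
      \<comment> \<open>The open hemisphere centred at y contains no antipodal pair.\<close>
      let ?U = "S2 \<inter> {z. 0 < y \<bullet> z}"
      show "openin (top_of_set S2) ?U" by (intro openin_open_Int open_Collect_less continuous_intros)
      show "y \<in> ?U" using y by (auto simp: dot_square_norm)
      show "inj_on q ?U" using qq by (auto simp: inj_on_def)
    qed
  qed (use cont surj antipodal_lifts[OF qq surj \<theta>] in auto)
  then show ?thesis by blast
qed

theorem theorem1:
  fixes X :: "'a topology" and V :: "'v set" and E :: "'v set set"
    and pt :: "'v \<Rightarrow> 'a" and curve :: "'v set \<Rightarrow> 'a set"
    and f :: "'v \<Rightarrow> nat" and n k :: nat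
  assumes "triangular_embedding X V E pt curve"
    and "card V = n" and "n \<ge> 4"
    and "k_coloring V k f"
    and "non_rainbow X V E pt curve f"
  shows "(sphere_surface X \<longrightarrow> int k \<le> \<lfloor>(2 * real n - 1) / 3\<rfloor>) \<and>
         (projective_plane_surface X \<longrightarrow> int k \<le> \<lfloor>(2 * real n + 1) / 3\<rfloor>)"
proof (intro conjI impI)
  have k: "card (f ` V) = k" using assms(4) by (simp add: k_coloring_def)
  have tri: "triangulation X q d V E pt curve" if "sphere_cover X q d" for q d
    using that assms(1) by (simp add: triangulation_def triangulation_axioms_def)
  show "int k \<le> \<lfloor>(2 * real n - 1) / 3\<rfloor>" if sphere: "sphere_surface X"
  proof -
    obtain q where "sphere_cover X q 1" using sphere_surface_cover[OF sphere] by blast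
    then have "3 * k + 4 \<le> 2 * n + 3"
      using triangulation.color_bound[OF tri, of q 1 f] assms(2,3,5) k by simp
    then show ?thesis by (simp add: le_floor_iff)
  qed
  show "int k \<le> \<lfloor>(2 * real n + 1) / 3\<rfloor>" if pp: "projective_plane_surface X"
  proof -
    obtain q where "sphere_cover X q 2" using projective_plane_surface_cover[OF pp] by blast
    \<comment> \<open>For d = 2 the color bound reads 6k + 4 <= 4n + 6, which is halved
      here.\<close>
    then have "3 * k + 2 \<le> 2 * n + 3"
      using triangulation.color_bound[OF tri, of q 2 f] assms(2,3,5) k by simp
    then show ?thesis by (simp add: le_floor_iff)
  qed
qed

end
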